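(* Let $B=K_{\aleph_0}$ be the countably infinite complete graph. For $k\in\mathbb N$, let $G_1,\dots,G_k\subseteq B$ be pairwise vertex disjoint graphs, each of which is a copy of $G_{\mathrm{star}}$ or of $G_{\mathrm{cli}}$. Then Maker has a winning strategy in the pattern preserving game $\mathrm{MB}_{\mathrm{pat}}(G_1,\dots,G_k)$.
   Context: For $j\in\mathbb N=\{1,2,\dots\}$, $K_j$ and $S_j$ denote the clique and the star on $j$ vertices, respectively. $G_{\mathrm{cli}}$ is the graph consisting of pairwise vertex disjoint cliques $\{K_j\}_{j\in\mathbb N}$ (one for each $j$), and $G_{\mathrm{star}}$ is the graph consisting of pairwise vertex disjoint stars $\{S_j\}_{j\in\mathbb N}$ (one for each $j$). Two players, Maker and Breaker, alternately claim previously unclaimed edges of $B=K_{\aleph_0}$, one edge per move; Maker moves first and the game lasts $\omega$ moves. Given graphs $G_1,\dots,G_k\subseteq B$, Maker wins the pattern preserving game $\mathrm{MB}_{\mathrm{pat}}(G_1,\dots,G_k)$ if there is a copy $K\subseteq B$ of $K_{\aleph_0}$, all of whose edges have been claimed by Maker, such that there exists a bijection $f\colon V(B)\to V(K)$ with $$\{x,y\}\in E(G_i)\iff\{f(x),f(y)\}\in E(G_i)\quad\text{for all }x,y\in V(B)\text{ and all }i\in\{1,\dots,k\}.$$ Otherwise Breaker wins. *)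

theory Defs
  imports Main
begin

record 'v graph =
  verts :: "'v set"
  edges :: "'v set set"

definition simple_graph :: "'v graph \<Rightarrow> bool" where
  "simple_graph G \<longleftrightarrow>
     (\<forall>e \<in> edges G. \<exists>x \<in> verts G. \<exists>y \<in> verts G. x \<noteq> y \<and> e = {x, y})"

definition subgraph :: "'v graph \<Rightarrow> 'v graph \<Rightarrow> bool" where
  "subgraph H G \<longleftrightarrow> simple_graph H \<and> verts H \<subseteq> verts G \<and> edges H \<subseteq> edges G"

definition copy_of :: "'v graph \<Rightarrow> 'w graph \<Rightarrow> bool" where
  "copy_of H G \<longleftrightarrow> simple_graph H \<and> simple_graph G \<and>
     (\<exists>\<phi>. bij_betw \<phi> (verts H) (verts G) \<and>
        (\<forall>x \<in> verts H. \<forall>y \<in> verts H. {x, y} \<in> edges H \<longleftrightarrow> {\<phi> x, \<phi> y} \<in> edges G))"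

definition K_aleph0 :: "nat graph" where
  "K_aleph0 = \<lparr>verts = UNIV, edges = {{x, y} | x y. x \<noteq> y}\<rparr>"

text \<open>
  The vertex \<open>(j, a)\<close> with \<open>a < j\<close> is the \<open>a\<close>-th vertex of the \<open>j\<close>-th component. Each
  component has \<open>j \<ge> 1\<close> vertices, so the first clique and the first star are isolated
  vertices. In the stars, \<open>(j, 0)\<close> is the centre.
\<close>

definition G_cli :: "(nat \<times> nat) graph" where
  "G_cli = \<lparr>verts = {(j, a). a < j},
            edges = {{(j, a), (j, b)} | j a b. a < j \<and> b < j \<and> a \<noteq> b}\<rparr>"

definition G_star :: "(nat \<times> nat) graph" where
  "G_star = \<lparr>verts = {(j, a). a < j},
             edges = {{(j, 0), (j, b)} | j b. 0 < b \<and> b < j}\<rparr>"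

text \<open>
  A play is the sequence of all claimed edges in the order of the moves: Maker makes the
  moves \<open>0, 2, 4, \<dots>\<close> and Breaker the moves \<open>1, 3, 5, \<dots>\<close>. A position is a finite initial
  part of a play.
\<close>

definition legal_play :: "'v graph \<Rightarrow> (nat \<Rightarrow> 'v set) \<Rightarrow> bool" where
  "legal_play B p \<longleftrightarrow> inj p \<and> range p \<subseteq> edges B"

definition legal_position :: "'v graph \<Rightarrow> 'v set list \<Rightarrow> bool" where
  "legal_position B h \<longleftrightarrow> distinct h \<and> set h \<subseteq> edges B"

definition maker_edges :: "(nat \<Rightarrow> 'v set) \<Rightarrow> 'v set set" where
  "maker_edges p = {p (2 * n) | n. True}"

definition maker_strategy :: "'v graph \<Rightarrow> ('v set list \<Rightarrow> 'v set) \<Rightarrow> bool" where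
  "maker_strategy B \<sigma> \<longleftrightarrow>
     (\<forall>h. legal_position B h \<and> even (length h) \<longrightarrow> \<sigma> h \<in> edges B - set h)"

definition follows :: "('v set list \<Rightarrow> 'v set) \<Rightarrow> (nat \<Rightarrow> 'v set) \<Rightarrow> bool" where
  "follows \<sigma> p \<longleftrightarrow> (\<forall>n. p (2 * n) = \<sigma> (map p [0..<2 * n]))"

definition maker_has_winning_strategy ::
    "'v graph \<Rightarrow> ((nat \<Rightarrow> 'v set) \<Rightarrow> bool) \<Rightarrow> bool" where
  "maker_has_winning_strategy B wins \<longleftrightarrow>
     (\<exists>\<sigma>. maker_strategy B \<sigma> \<and> (\<forall>p. legal_play B p \<and> follows \<sigma> p \<longrightarrow> wins p))"

definition MB_pat ::
    "'v graph \<Rightarrow> nat \<Rightarrow> (nat \<Rightarrow> 'v graph) \<Rightarrow> (nat \<Rightarrow> 'v set) \<Rightarrow> bool" where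
  "MB_pat B k G p \<longleftrightarrow>
     (\<exists>K. subgraph K B \<and> copy_of K K_aleph0 \<and> edges K \<subseteq> maker_edges p \<and>
        (\<exists>f. bij_betw f (verts B) (verts K) \<and>
           (\<forall>x \<in> verts B. \<forall>y \<in> verts B. \<forall>i \<in> {1..k}.
              {x, y} \<in> edges (G i) \<longleftrightarrow> {f x, f y} \<in> edges (G i))))"

end

theory Submission imports Defs begin

text \<open>
  Maker grows a finitely branching tree of vertices whose paths from the root are cliques of her graph; by
  Koenig's lemma an infinite tree yields an infinite clique. A fresh vertex is attached to the tree level by
  level: Breaker answers each edge by destroying one other, so if the branching is large compared with the
  number of moves spent so far, the vertex becomes adjacent to a whole subtree that still branches, only less.

  A path must run through centres and leaves of the components of each colour in turn. A leaf cannot follow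
  its centre along a single path, since Breaker would block the next edge, but it can follow the centre into a
  branching subtree. So a centre is attached first, to a branching subtree, and then many of its leaves, each
  to a smaller subtree. Either the leaves accumulate at one frontier node that expects this colour, until they
  contain a large clique, or Breaker keeps one of them away from all such nodes, and then Maker continues with
  the next colour in the branching subtree reached by that leaf. With finitely many colours this ends after
  boundedly many shrinkings, and one frontier node receives a new block.
\<close>

text \<open>The obstacle is that components are finite. A component must have more leaves than the
  coming rounds can touch, so these rounds have to be counted from the tree alone, before the
  component is chosen. Hence branching is prescribed as a function of depth, and the cost of
  attaching a vertex is read off from the branching that is to survive, not from the actual tree.

  A block needs a clique of leaves instead of one list, since then every list of distinct leaves is
  a path and these paths branch again. The accumulation of leaves is finite for a counting reason: a
  leaf that neither eliminates the colour nor completes a clique becomes a new node of a tree with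
  bounded height and branching.

  Block \<open>b\<close> has \<open>Suc b\<close> vertices and the colours recur cyclically, so
  every component of every \<open>G i\<close> finds a block that is long enough, and blocks remain
  for the vertices outside all \<open>G i\<close>.\<close>

lemma edge_iff [simp]: "{x, y} \<in> edges K_aleph0 \<longleftrightarrow> x \<noteq> y"
  by (auto simp: K_aleph0_def doubleton_eq_iff)

subsection \<open>Forcing in boundedly many moves\<close>

definition position :: "nat set set \<Rightarrow> nat set set \<Rightarrow> bool" where
  "position M B \<longleftrightarrow> finite M \<and> finite B \<and> M \<subseteq> edges K_aleph0 \<and> B \<subseteq> edges K_aleph0"

text \<open>
  The number of moves is bounded in advance, because Maker has to choose a component that is large
  compared with the number of moves that she will spend on it.
\<close>

fun force :: "nat \<Rightarrow> (nat set set \<Rightarrow> nat set set \<Rightarrow> bool) \<Rightarrow> nat set set \<Rightarrow> nat set set \<Rightarrow> bool" where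
  "force 0 Q M B \<longleftrightarrow> Q M B"
| "force (Suc n) Q M B \<longleftrightarrow> Q M B \<or>
     (\<exists>e \<in> edges K_aleph0 - M - B. \<forall>e' \<in> edges K_aleph0 - M - B - {e}.
        force n Q (insert e M) (insert e' B))"

definition reach :: "nat \<Rightarrow> nat set set \<Rightarrow> nat set set \<Rightarrow> nat set set \<Rightarrow> nat set set \<Rightarrow> bool" where
  "reach n M B M' B' \<longleftrightarrow>
     position M' B' \<and> M \<subseteq> M' \<and> B \<subseteq> B' \<and> card (M' - M) \<le> n \<and> card (B' - B) \<le> n"

lemma force_here: "Q M B \<Longrightarrow> force n Q M B"
  by (cases n) auto

lemma force_mono: "force n Q M B \<Longrightarrow> n \<le> m \<Longrightarrow> force m Q M B"
proof (induction n arbitrary: M B m)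
  case 0 then show ?case by (simp add: force_here)
next
  case (Suc n)
  then obtain m' where m: "m = Suc m'" "n \<le> m'" by (cases m) auto
  have "force m' Q M' B'" if "force n Q M' B'" for M' B' using Suc.IH[OF that m(2)] .
  show ?case
  proof (cases "Q M B")
    case True
    then show ?thesis by (rule force_here)
  next
    case False
    then obtain e where "e \<in> edges K_aleph0 - M - B"
      "\<And>e'. e' \<in> edges K_aleph0 - M - B - {e} \<Longrightarrow> force n Q (insert e M) (insert e' B)"
      using Suc.prems(1) unfolding force.simps(2) by metis
    then show ?thesis
      using Suc.IH[OF _ m(2)] unfolding m(1) force.simps(2)
      by (intro disjI2 bexI[of _ e] ballI) blast+
  qed
qed

lemma reach_Suc:
  assumes "position M B" and "reach n (insert e M) (insert e' B) M' B'"
  shows "reach (Suc n) M B M' B'"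
proof -
  have "finite M'" "finite B'" using assms(2) by (auto simp: reach_def position_def)
  then have "card (M' - M) \<le> card (insert e (M' - insert e M))" "card (B' - B) \<le> card (insert e' (B' - insert e' B))"
    by (auto intro!: card_mono simp del: card_insert_disjoint)
  moreover have "card (insert e (M' - insert e M)) \<le> Suc n" "card (insert e' (B' - insert e' B)) \<le> Suc n"
    using assms by (auto simp: reach_def position_def card_insert_if)
  ultimately show ?thesis
    using assms by (auto simp: reach_def)
qed

text \<open>Phases of play are concatenated. The counts in \<open>reach\<close> tell the second
  phase how much Breaker can have spoiled during the first.\<close>

lemma force_bind:
  assumes "force n Q M B" and "position M B"
    and "\<And>M' B'. \<lbrakk>reach n M B M' B'; Q M' B'\<rbrakk> \<Longrightarrow> force m R M' B'"
  shows "force (n + m) R M B"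
  using assms
proof (induction n arbitrary: M B)
  case 0
  then show ?case by (simp add: reach_def)
next
  case (Suc n)
  show ?case
  proof (cases "Q M B")
    case True
    then have "force m R M B" using Suc.prems by (simp add: reach_def)
    then show ?thesis by (rule force_mono) simp
  next
    case False
    then obtain e where e: "e \<in> edges K_aleph0 - M - B"
      and *: "\<And>e'. e' \<in> edges K_aleph0 - M - B - {e} \<Longrightarrow> force n Q (insert e M) (insert e' B)"
      using Suc.prems(1) by auto
    have "force (n + m) R (insert e M) (insert e' B)" if e': "e' \<in> edges K_aleph0 - M - B - {e}" for e'
    proof (rule Suc.IH[OF *[OF e']])
      show "position (insert e M) (insert e' B)"
        using Suc.prems(2) e e' by (auto simp: position_def)
      show "force m R M' B'" if "reach n (insert e M) (insert e' B) M' B'" "Q M' B'" for M' B'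
        using Suc.prems(3) reach_Suc[OF Suc.prems(2) that(1)] that(2) by blast
    qed
    then show ?thesis using e by auto
  qed
qed

lemma force_conseq:
  assumes "force n Q M B" and "position M B"
    and "\<And>M' B'. \<lbrakk>reach n M B M' B'; Q M' B'\<rbrakk> \<Longrightarrow> R M' B'"
  shows "force n R M B"
  using force_bind[OF assms(1,2), of 0 R] assms(3) by simp

lemma force_claim:
  assumes "e \<in> edges K_aleph0 - M - B" and "position M B"
    and "\<And>M' B'. reach 1 M B M' B' \<Longrightarrow> e \<in> M' \<Longrightarrow> force n Q M' B'"
  shows "force (Suc n) Q M B"
proof -
  have "force 1 (\<lambda>M' B'. e \<in> M') M B" using assms(1) by (auto simp: eval_nat_numeral)
  from force_bind[OF this assms(2,3)] show ?thesis by simp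
qed

section \<open>Many edges at one vertex against one reply per move\<close>

definition kill :: "nat set set \<Rightarrow> nat \<Rightarrow> nat" where
  "kill B v = card {e \<in> B. v \<in> e}"

lemma kill_reach:
  assumes "reach n M B M' B'" shows "kill B' v \<le> kill B v + n"
proof -
  have f: "finite B'" "finite B" using assms by (auto simp: reach_def position_def intro: finite_subset)
  have "{e \<in> B'. v \<in> e} \<subseteq> {e \<in> B. v \<in> e} \<union> (B' - B)" by auto
  then have "card {e \<in> B'. v \<in> e} \<le> card ({e \<in> B. v \<in> e} \<union> (B' - B))"
    using f by (intro card_mono) auto
  also have "\<dots> \<le> card {e \<in> B. v \<in> e} + card (B' - B)" by (rule card_Un_le)
  finally show ?thesis using assms by (simp add: kill_def reach_def)
qed

lemma unkilled:
  assumes "finite B" and "kill B v < card C"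
  shows "\<exists>x \<in> C. {v, x} \<notin> B"
proof (rule ccontr)
  assume "\<not> ?thesis"
  then have "(\<lambda>x. {v, x}) ` C \<subseteq> {e \<in> B. v \<in> e}" by auto
  then have "card ((\<lambda>x. {v, x}) ` C) \<le> kill B v"
    unfolding kill_def using assms by (intro card_mono) auto
  moreover have "inj_on (\<lambda>x. {v, x}) C" by (auto simp: inj_on_def doubleton_eq_iff)
  ultimately show False using assms by (simp add: card_image)
qed

text \<open>Each round uses up one candidate and the reply spoils at most one more, hence
  \<open>b + b\<close>; \<open>kill B v\<close> pays for the candidates blocked beforehand. An edge
  that Maker already owns is taken without a move.\<close>

lemma force_neighbours:
  assumes "position M B" and "finite C" and "v \<notin> C" and "b + b + kill B v \<le> card C"
  shows "force b (\<lambda>M' B'. \<exists>D \<subseteq> C. card D = b \<and> (\<forall>x \<in> D. {v, x} \<in> M')) M B"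
  using assms
proof (induction b arbitrary: M B C)
  case 0
  have "\<exists>D \<subseteq> C. card D = 0 \<and> (\<forall>x \<in> D. {v, x} \<in> M)" by (rule exI[of _ "{}"]) simp
  then show ?case by simp
next
  case (Suc b)
  let ?Q = "\<lambda>b C (M' :: nat set set) (B' :: nat set set). \<exists>D \<subseteq> C. card D = b \<and> (\<forall>x \<in> D. {v, x} \<in> M')"
  obtain x where x: "x \<in> C" "{v, x} \<notin> B"
    using unkilled[of B v C] Suc.prems by (auto simp: position_def)
  have rest: "force b (?Q (Suc b) C) M' B'"
    if r: "reach 1 M B M' B'" and xM: "{v, x} \<in> M'" for M' B'
  proof -
    have "b + b + kill B' v \<le> card (C - {x})"
      using Suc.prems x kill_reach[OF r, of v] by simp
    then have "force b (?Q b (C - {x})) M' B'"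
      using Suc.prems r by (intro Suc.IH) (auto simp: reach_def)
    then show ?thesis
    proof (rule force_conseq)
      show "position M' B'" using r by (simp add: reach_def)
      fix M'' B'' assume r': "reach b M' B' M'' B''" and "?Q b (C - {x}) M'' B''"
      then obtain D where D: "D \<subseteq> C - {x}" "card D = b" "\<forall>z \<in> D. {v, z} \<in> M''" by auto
      have "finite D" using D Suc.prems(2) by (meson finite_Diff finite_subset)
      then have "card (insert x D) = Suc b" using D by (subst card_insert_disjoint) auto
      then show "?Q (Suc b) C M'' B''"
        using D x xM r' by (intro exI[of _ "insert x D"]) (auto simp: reach_def)
    qed
  qed
  show ?case
  proof (cases "{v, x} \<in> M")
    case True
    then have "force b (?Q (Suc b) C) M B"
      using Suc.prems by (intro rest) (auto simp: reach_def)
    then show ?thesis by (rule force_mono) simp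
  next
    case False
    have "x \<noteq> v" using x Suc.prems by auto
    then show ?thesis using False x Suc.prems rest
      by (intro force_claim[where e = "{v, x}"]) auto
  qed
qed

text \<open>The sets \<open>C a\<close> are served in turn. The last one has suffered at most
  \<open>(card A - 1) * b\<close> replies and needs \<open>b + b\<close> of its own. They may
  overlap, since an edge claimed for one of them counts for all.\<close>

lemma force_neighbours_family:
  assumes "finite A" and "position M B"
    and "\<And>a. a \<in> A \<Longrightarrow> finite (C a) \<and> v \<notin> C a \<and> card A * b + b + kill B v \<le> card (C a)"
  shows "force (card A * b)
    (\<lambda>M' B'. \<exists>D. \<forall>a \<in> A. D a \<subseteq> C a \<and> card (D a) = b \<and> (\<forall>x \<in> D a. {v, x} \<in> M')) M B"
  using assms
proof (induction A arbitrary: M B rule: finite_induct)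
  case empty
  then show ?case by simp
next
  case (insert a A)
  let ?Q = "\<lambda>A (M' :: nat set set) (B' :: nat set set).
    \<exists>D. \<forall>a \<in> A. D a \<subseteq> C a \<and> card (D a) = b \<and> (\<forall>x \<in> D a. {v, x} \<in> M')"
  have "force (card A * b) (?Q A) M B"
  proof (rule insert.IH[OF insert.prems(1)])
    fix c assume "c \<in> A"
    then show "finite (C c) \<and> v \<notin> C c \<and> card A * b + b + kill B v \<le> card (C c)"
      using insert.prems(2)[of c] insert.hyps by simp
  qed
  then have "force (card A * b + b) (?Q (insert a A)) M B"
  proof (rule force_bind[OF _ insert.prems(1)])
    fix M' B' assume r: "reach (card A * b) M B M' B'" and "?Q A M' B'"
    then obtain D where D: "\<forall>a \<in> A. D a \<subseteq> C a \<and> card (D a) = b \<and> (\<forall>x \<in> D a. {v, x} \<in> M')" by blast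
    have "b + b + kill B' v \<le> card (C a)"
      using insert.prems(2)[of a] insert.hyps kill_reach[OF r, of v] by (simp add: algebra_simps)
    then have "force b (\<lambda>M' B'. \<exists>D \<subseteq> C a. card D = b \<and> (\<forall>x \<in> D. {v, x} \<in> M')) M' B'"
      using r insert.prems by (intro force_neighbours) (auto simp: reach_def)
    then show "force b (?Q (insert a A)) M' B'"
    proof (rule force_conseq)
      show "position M' B'" using r by (simp add: reach_def)
      fix M'' B'' assume r': "reach b M' B' M'' B''"
        and "\<exists>D \<subseteq> C a. card D = b \<and> (\<forall>x \<in> D. {v, x} \<in> M'')"
      then obtain D' where "D' \<subseteq> C a" "card D' = b" "\<forall>x \<in> D'. {v, x} \<in> M''" by auto
      then show "?Q (insert a A) M'' B''"
        using D r' insert.hyps by (intro exI[of _ "D(a := D')"]) (auto simp: reach_def)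
    qed
  qed
  then show ?case using insert.hyps by (simp add: algebra_simps)
qed

subsection \<open>Attaching a vertex to a tree\<close>

text \<open>A tree is a set of paths from the root, so one vertex may occur in many nodes.\<close>

definition children :: "nat list set \<Rightarrow> nat list \<Rightarrow> nat set" where
  "children S xs = {x. xs @ [x] \<in> S}"

lemma finite_children [simp]: "finite S \<Longrightarrow> finite (children S xs)"
proof -
  assume "finite S"
  then have "finite (last ` S)" by simp
  moreover have "children S xs \<subseteq> last ` S" by (force simp: children_def image_iff)
  ultimately show ?thesis by (rule finite_subset[rotated])
qed

lemma children_mono: "S \<subseteq> S' \<Longrightarrow> children S xs \<subseteq> children S' xs"
  by (auto simp: children_def)

lemma card_children_mono: "S \<subseteq> S' \<Longrightarrow> finite S' \<Longrightarrow> card (children S xs) \<le> card (children S' xs)"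
  by (intro card_mono children_mono) auto

definition wide :: "(nat \<Rightarrow> nat) \<Rightarrow> nat list set \<Rightarrow> nat list set \<Rightarrow> bool" where
  "wide \<beta> F S \<longleftrightarrow> [] \<in> S \<and> (\<forall>xs \<in> S. xs \<in> F \<or> \<beta> (length xs) \<le> card (children S xs))"

definition level_size :: "(nat \<Rightarrow> nat) \<Rightarrow> nat \<Rightarrow> nat" where
  "level_size \<beta> d = (\<Prod>e<d. \<beta> e)"

definition tree_size :: "(nat \<Rightarrow> nat) \<Rightarrow> nat \<Rightarrow> nat" where
  "tree_size \<beta> d = (\<Sum>e<d. level_size \<beta> (Suc e))"

text \<open>
  Breaker destroys at most one edge at \<open>v\<close> per move of Maker. Attaching \<open>v\<close> level by level, Maker has made
  at most \<open>tree_size \<beta> (Suc d)\<close> moves when depth \<open>d\<close> is finished, whatever the height of the tree is. The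
  \<open>Suc\<close> allows for one edge that Breaker has at \<open>v\<close> beforehand.
\<close>

definition widen :: "(nat \<Rightarrow> nat) \<Rightarrow> nat \<Rightarrow> nat" where
  "widen \<beta> d = Suc (tree_size \<beta> (Suc d) + \<beta> d)"

text \<open>Taking exactly \<open>\<beta> d\<close> children of each node at depth \<open>d\<close>
  keeps the next level of \<open>Z\<close> small, so the cost of a level depends on
  \<open>\<beta>\<close> and not on the actual width of \<open>S\<close>.\<close>

lemma force_attach_level:
  assumes "position M B" and "finite S" and "wide (widen \<beta>) F S" and "kill B v \<le> 1"
    and "\<And>xs. xs \<in> S \<Longrightarrow> v \<notin> set xs"
  shows "force (tree_size \<beta> d) (\<lambda>M' B'. \<exists>Z \<subseteq> S. [] \<in> Z \<and>
      (\<forall>xs \<in> Z. length xs \<le> d \<and> (\<forall>x \<in> set xs. {v, x} \<in> M')) \<and>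
      (\<forall>xs \<in> Z. length xs < d \<longrightarrow> xs \<in> F \<or> \<beta> (length xs) \<le> card (children Z xs)) \<and>
      card {xs \<in> Z. length xs = d} \<le> level_size \<beta> d) M B"
    (is "force _ (?Q d) _ _")
proof (induction d)
  case 0
  have "?Q 0 M B"
    using assms(3) by (intro exI[of _ "{[]}"]) (auto simp: wide_def level_size_def card_le_Suc0_iff_eq)
  then show ?case by (simp add: tree_size_def)
next
  case (Suc d)
  have "force (tree_size \<beta> d + level_size \<beta> (Suc d)) (?Q (Suc d)) M B"
  proof (rule force_bind[OF Suc assms(1)])
    fix M' B' assume r: "reach (tree_size \<beta> d) M B M' B'" and "?Q d M' B'"
    then obtain Z where Z: "Z \<subseteq> S" "[] \<in> Z"
      "\<And>xs. xs \<in> Z \<Longrightarrow> length xs \<le> d \<and> (\<forall>x \<in> set xs. {v, x} \<in> M')"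
      "\<And>xs. xs \<in> Z \<Longrightarrow> length xs < d \<Longrightarrow> xs \<in> F \<or> \<beta> (length xs) \<le> card (children Z xs)"
      "card {xs \<in> Z. length xs = d} \<le> level_size \<beta> d" by blast
    \<comment> \<open>Paths may stop in \<open>F\<close>, so only the other nodes on the last level
      have to be served.\<close>
    define A where "A = {xs \<in> Z. length xs = d \<and> xs \<notin> F}"
    have finZ: "finite Z" using Z(1) assms(2) by (rule finite_subset)
    have "card A \<le> card {xs \<in> Z. length xs = d}"
      using finZ unfolding A_def by (intro card_mono) auto
    then have cA: "card A * \<beta> d \<le> level_size \<beta> (Suc d)"
      using Z(5) by (simp add: level_size_def)
    have kB: "kill B' v \<le> 1 + tree_size \<beta> d" using kill_reach[OF r, of v] assms(4) by simp
    have "force (card A * \<beta> d) (\<lambda>M' B'. \<exists>D. \<forall>a \<in> A. D a \<subseteq> children S a \<and>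
      card (D a) = \<beta> d \<and> (\<forall>x \<in> D a. {v, x} \<in> M')) M' B'"
    proof (rule force_neighbours_family)
      fix a assume a: "a \<in> A"
      then have "widen \<beta> d \<le> card (children S a)"
        using Z(1) assms(3) by (auto simp: A_def wide_def)
      moreover have "card A * \<beta> d + \<beta> d + kill B' v \<le> widen \<beta> d"
        using cA kB by (simp add: widen_def tree_size_def)
      moreover have "v \<notin> children S a" using assms(5) by (force simp: children_def)
      ultimately show "finite (children S a) \<and> v \<notin> children S a \<and>
        card A * \<beta> d + \<beta> d + kill B' v \<le> card (children S a)" using assms(2) by simp
    next
      show "finite A" "position M' B'" using finZ r by (auto simp: A_def reach_def)
    qed
    then have "force (level_size \<beta> (Suc d)) (\<lambda>M' B'. \<exists>D. \<forall>a \<in> A. D a \<subseteq> children S a \<and>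
      card (D a) = \<beta> d \<and> (\<forall>x \<in> D a. {v, x} \<in> M')) M' B'" by (rule force_mono[OF _ cA])
    then show "force (level_size \<beta> (Suc d)) (?Q (Suc d)) M' B'"
    proof (rule force_conseq)
      show "position M' B'" using r by (simp add: reach_def)
      fix M'' B'' assume r': "reach (level_size \<beta> (Suc d)) M' B' M'' B''"
        and "\<exists>D. \<forall>a \<in> A. D a \<subseteq> children S a \<and> card (D a) = \<beta> d \<and> (\<forall>x \<in> D a. {v, x} \<in> M'')"
      then obtain D where D: "\<And>a. a \<in> A \<Longrightarrow> D a \<subseteq> children S a"
        "\<And>a. a \<in> A \<Longrightarrow> card (D a) = \<beta> d" "\<And>a x. a \<in> A \<Longrightarrow> x \<in> D a \<Longrightarrow> {v, x} \<in> M''" by metis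
      define N where "N = (\<Union>a \<in> A. (\<lambda>x. a @ [x]) ` D a)"
      define Z' where "Z' = Z \<union> N"
      have MM: "M' \<subseteq> M''" using r' by (simp add: reach_def)
      have "N \<subseteq> S" using D(1) by (auto simp: N_def children_def)
      then have "Z' \<subseteq> S" using Z(1) by (auto simp: Z'_def)
      then have finZ': "finite Z'" using assms(2) by (rule finite_subset)
      have N: "xs \<in> N \<Longrightarrow> length xs = Suc d" for xs by (auto simp: N_def A_def)
      have adj: "length xs \<le> Suc d \<and> (\<forall>x \<in> set xs. {v, x} \<in> M'')" if "xs \<in> Z'" for xs
        using that Z(3) D(3) MM by (fastforce simp: Z'_def N_def A_def)
      have br: "xs \<in> F \<or> \<beta> (length xs) \<le> card (children Z' xs)" if *: "xs \<in> Z'" "length xs < Suc d" for xs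
      proof -
        have xs: "xs \<in> Z" using that N by (auto simp: Z'_def)
        consider "length xs < d" | "length xs = d" "xs \<in> F" | "length xs = d" "xs \<in> A"
          using * xs by (force simp: A_def)
        then show ?thesis
        proof cases
          case 1
          then show ?thesis using Z(4)[OF xs] card_children_mono[of Z Z' xs] finZ'
            by (fastforce simp: Z'_def)
        next
          case 3
          then have "D xs \<subseteq> children Z' xs" by (auto simp: children_def Z'_def N_def)
          then have "card (D xs) \<le> card (children Z' xs)" using finZ' by (intro card_mono) auto
          then show ?thesis using D(2) 3 by simp
        qed simp
      qed
      have "{xs \<in> Z'. length xs = Suc d} \<subseteq> N" using Z(3) by (force simp: Z'_def)
      then have "card {xs \<in> Z'. length xs = Suc d} \<le> card N"
        using finZ' by (intro card_mono) (auto simp: Z'_def)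
      also have "\<dots> \<le> (\<Sum>a\<in>A. card ((\<lambda>x. a @ [x]) ` D a))"
        unfolding N_def using finZ by (intro card_UN_le) (auto simp: A_def)
      also have "\<dots> \<le> (\<Sum>a\<in>A. \<beta> d)"
      proof (rule sum_mono)
        fix a assume a: "a \<in> A"
        have "finite (D a)" using D(1)[OF a] assms(2) by (meson finite_children finite_subset)
        then show "card ((\<lambda>x. a @ [x]) ` D a) \<le> \<beta> d" using card_image_le D(2)[OF a] by metis
      qed
      also have "\<dots> \<le> level_size \<beta> (Suc d)" using cA by simp
      finally have "card {xs \<in> Z'. length xs = Suc d} \<le> level_size \<beta> (Suc d)" .
      then show "?Q (Suc d) M'' B''"
        using \<open>Z' \<subseteq> S\<close> Z(2) adj br by (intro exI[of _ Z']) (auto simp: Z'_def)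
    qed
  qed
  then show ?case by (simp add: tree_size_def)
qed

text \<open>Once \<open>d\<close> exceeds all lengths in \<open>S\<close>, the truncation at depth
  \<open>d\<close> disappears.\<close>

lemma force_attach:
  assumes "position M B" and "finite S" and "wide (widen \<beta>) F S" and "kill B v \<le> 1"
    and "\<And>xs. xs \<in> S \<Longrightarrow> v \<notin> set xs" and "\<And>xs. xs \<in> S \<Longrightarrow> length xs < d"
  shows "force (tree_size \<beta> d) (\<lambda>M' B'. \<exists>Z \<subseteq> S. wide \<beta> F Z \<and>
      (\<forall>xs \<in> Z. \<forall>x \<in> set xs. {v, x} \<in> M')) M B"
proof (rule force_conseq[OF force_attach_level[OF assms(1-5), of d] assms(1)])
  fix M' B'
  assume "\<exists>Z \<subseteq> S. [] \<in> Z \<and>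
      (\<forall>xs \<in> Z. length xs \<le> d \<and> (\<forall>x \<in> set xs. {v, x} \<in> M')) \<and>
      (\<forall>xs \<in> Z. length xs < d \<longrightarrow> xs \<in> F \<or> \<beta> (length xs) \<le> card (children Z xs)) \<and>
      card {xs \<in> Z. length xs = d} \<le> level_size \<beta> d"
  then obtain Z where "Z \<subseteq> S" "[] \<in> Z" "\<forall>xs \<in> Z. \<forall>x \<in> set xs. {v, x} \<in> M'"
    "\<forall>xs \<in> Z. length xs < d \<longrightarrow> xs \<in> F \<or> \<beta> (length xs) \<le> card (children Z xs)" by blast
  moreover from this have "length xs < d" if "xs \<in> Z" for xs using assms(6) that by blast
  ultimately show "\<exists>Z \<subseteq> S. wide \<beta> F Z \<and> (\<forall>xs \<in> Z. \<forall>x \<in> set xs. {v, x} \<in> M')"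
    by (intro exI[of _ Z]) (auto simp: wide_def)
qed

lemma widen_ge: "\<beta> d \<le> widen \<beta> d"
  by (simp add: widen_def)

subsection \<open>The tree of Maker-cliques\<close>

definition touched :: "nat set set \<Rightarrow> nat set set \<Rightarrow> nat set" where
  "touched M B = \<Union>M \<union> \<Union>B"

lemma card_Union_edges:
  assumes "finite A" and "A \<subseteq> edges K_aleph0"
  shows "finite (\<Union>A) \<and> card (\<Union>A) \<le> 2 * card A"
  using assms
proof (induction A rule: finite_induct)
  case (insert e A)
  then obtain x y where "e = {x, y}" by (auto simp: K_aleph0_def)
  then have e: "finite e" "card e \<le> 2" by (auto simp: card_insert_if)
  have "card (e \<union> \<Union>A) \<le> card e + card (\<Union>A)" by (rule card_Un_le)
  then show ?case using insert e by auto
qed simp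

lemma finite_touched: "position M B \<Longrightarrow> finite (touched M B)"
  using card_Union_edges[of M] card_Union_edges[of B] by (auto simp: touched_def position_def)

text \<open>A round claims two edges and so touches at most four new vertices.\<close>

lemma touched_reach:
  assumes "reach n M B M' B'" and "finite L"
  shows "card (L \<inter> touched M' B') \<le> card (L \<inter> touched M B) + 4 * n"
proof -
  have u: "finite (\<Union>A) \<and> card (\<Union>A) \<le> 2 * n"
    if "finite A" "A \<subseteq> edges K_aleph0" "card A \<le> n" for A
    using card_Union_edges[OF that(1,2)] that(3) by linarith
  have M: "finite (\<Union>(M' - M))" "card (\<Union>(M' - M)) \<le> 2 * n"
    and B: "finite (\<Union>(B' - B))" "card (\<Union>(B' - B)) \<le> 2 * n"
    using assms(1) u[of "M' - M"] u[of "B' - B"] by (auto simp: reach_def position_def)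
  have "L \<inter> touched M' B' \<subseteq> (L \<inter> touched M B) \<union> (\<Union>(M' - M) \<union> \<Union>(B' - B))"
    by (auto simp: touched_def)
  then have "card (L \<inter> touched M' B') \<le> card ((L \<inter> touched M B) \<union> (\<Union>(M' - M) \<union> \<Union>(B' - B)))"
    using M B assms(2) by (intro card_mono) auto
  also have "\<dots> \<le> card (L \<inter> touched M B) + card (\<Union>(M' - M) \<union> \<Union>(B' - B))" by (rule card_Un_le)
  also have "\<dots> \<le> card (L \<inter> touched M B) + (card (\<Union>(M' - M)) + card (\<Union>(B' - B)))"
    by (simp add: card_Un_le)
  finally show ?thesis using M B by simp
qed

lemma kill_untouched: "v \<notin> touched M B \<Longrightarrow> kill B v = 0"
proof -
  assume "v \<notin> touched M B"
  then have "{e \<in> B. v \<in> e} = {}" by (auto simp: touched_def)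
  then show ?thesis unfolding kill_def by (simp only: card.empty)
qed

definition clique :: "nat set set \<Rightarrow> nat set \<Rightarrow> bool" where
  "clique M A \<longleftrightarrow> (\<forall>x \<in> A. \<forall>y \<in> A. x \<noteq> y \<longrightarrow> {x, y} \<in> M)"

lemma clique_mono: "clique M A \<Longrightarrow> M \<subseteq> M' \<Longrightarrow> A' \<subseteq> A \<Longrightarrow> clique M' A'"
  unfolding clique_def by blast

lemma clique_insert: "clique M (insert v A) \<longleftrightarrow> clique M A \<and> (\<forall>x \<in> A. v \<noteq> x \<longrightarrow> {v, x} \<in> M)"
  by (auto simp: clique_def insert_commute doubleton_eq_iff)

text \<open>
  Position \<open>start b + a\<close> with \<open>a \<le> b\<close> of a path is the \<open>a\<close>-th vertex of block \<open>b\<close>: the centre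
  for \<open>a = 0\<close>, a leaf otherwise. Block \<open>b\<close> has colour \<open>b mod k\<close>.
\<close>

definition start :: "nat \<Rightarrow> nat" where
  "start b = (\<Sum>a<b. Suc a)"

lemma start_0 [simp]: "start 0 = 0" and start_Suc [simp]: "start (Suc b) = start b + Suc b"
  by (simp_all add: start_def)

lemma start_mono: "a \<le> b \<Longrightarrow> start a \<le> start b"
  by (rule lift_Suc_mono_le[of start]) auto

lemma start_less: "a < b \<Longrightarrow> start a + a < start b"
  using start_mono[of "Suc a" b] by simp

lemma start_inj [simp]: "start a = start b \<longleftrightarrow> a = b"
  by (metis start_less linorder_neqE_nat not_add_less1)

lemma le_start: "b \<le> start b"
  by (induction b) auto

lemma start_block_unique:
  assumes "start a + i = start b + j" "i \<le> a" "j \<le> b"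
  shows "a = b \<and> i = j"
  using assms start_less[of a b] start_less[of b a] by (cases a b rule: linorder_cases) auto

lemma card_children_tree_le:
  assumes "finite E" and "\<And>r p. p \<in> X r \<Longrightarrow> card (children E p) \<le> C"
    and "\<And>r xs. xs \<in> X (Suc r) \<Longrightarrow> \<exists>p \<in> X r. \<exists>x \<in> children E p. xs = p @ [x]"
    and "finite (X 0)"
  shows "finite (X r) \<and> card (X r) \<le> card (X 0) * C ^ r"
proof (induction r)
  case (Suc r)
  let ?U = "\<Union>p \<in> X r. (\<lambda>x. p @ [x]) ` children E p"
  have sub: "X (Suc r) \<subseteq> ?U" using assms(3) by blast
  have fin: "finite ?U" using Suc assms(1) by auto
  have "card ?U \<le> (\<Sum>p\<in>X r. card ((\<lambda>x. p @ [x]) ` children E p))"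
    using Suc by (intro card_UN_le) auto
  also have "\<dots> \<le> (\<Sum>p\<in>X r. C)"
    using assms(1,2) by (intro sum_mono) (meson card_image_le finite_children order_trans)
  also have "\<dots> \<le> card (X 0) * C ^ Suc r" using Suc by simp
  finally show ?case using card_mono[OF fin sub] finite_subset[OF sub fin] by linarith
qed (use assms(4) in simp)

text \<open>A deepest node with \<open>P\<close> has no child, which would inherit \<open>P\<close>;
  as branching is positive outside \<open>F\<close>, the node lies in \<open>F\<close>.\<close>

lemma wide_frontier:
  assumes "finite Z" and "wide \<beta> F Z" and "\<And>d. 1 \<le> \<beta> d"
    and "xs \<in> Z" and "P xs" and "\<And>ys x. ys \<in> Z \<Longrightarrow> P ys \<Longrightarrow> ys @ [x] \<in> Z \<Longrightarrow> P (ys @ [x])"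
  shows "\<exists>ys \<in> Z \<inter> F. P ys"
proof -
  let ?Y = "{ys \<in> Z. P ys}"
  have Y: "finite ?Y" "?Y \<noteq> {}" using assms by auto
  define m where "m = Max (length ` ?Y)"
  have "m \<in> length ` ?Y" unfolding m_def using Y by (intro Max_in) auto
  then obtain ys where ys: "ys \<in> Z" "P ys" "length ys = m" by auto
  have "ys \<in> F"
  proof (rule ccontr)
    assume "ys \<notin> F"
    then have "1 \<le> card (children Z ys)" using assms(2,3) ys by (meson order_trans wide_def)
    then obtain x where "x \<in> children Z ys" by fastforce
    then have "ys @ [x] \<in> ?Y" using assms(6) ys by (auto simp: children_def)
    then have "length (ys @ [x]) \<le> m" unfolding m_def using Y(1) by (intro Max_ge imageI finite_imageI)
    then show False using ys by simp
  qed
  then show ?thesis using ys by auto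
qed

text \<open>
  \<open>U i\<close> consists of the pairs (centre, leaves) of the components of colour \<open>i\<close>. A clique is treated
  like a star: any of its vertices serves as centre.
\<close>

locale star_supply =
  fixes k :: nat and U :: "nat \<Rightarrow> (nat \<times> nat set) set"
  assumes k_pos: "0 < k"
    and fresh_unit: "\<And>i X m. i < k \<Longrightarrow> finite X \<Longrightarrow>
      \<exists>c L. (c, L) \<in> U i \<and> finite L \<and> c \<notin> L \<and> m \<le> card L \<and> insert c L \<inter> X = {}"
begin

text \<open>
  One colour costs two widenings, one for its centre and one for its leaves.
\<close>

definition width :: "nat \<Rightarrow> nat \<Rightarrow> nat" where
  "width j = (widen ^^ j) (\<lambda>_. 1)"

lemma width_pos: "1 \<le> width j d"
  by (induction j) (auto simp: width_def intro: order_trans[OF _ widen_ge])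

abbreviation full :: "nat \<Rightarrow> nat" where
  "full \<equiv> width (2 * k)"

text \<open>In a set of this many leaves, a path that has used fewer than \<open>b\<close> of them
  still has \<open>full d\<close> continuations, at any depth \<open>d \<le> start b + b\<close>.
  The summand \<open>b\<close> pays for the leaves already used.\<close>

definition leaves :: "nat \<Rightarrow> nat" where
  "leaves b = b + (\<Sum>d\<le>start b + b. full d)"

text \<open>A branching bound common to all stages, needed for Koenig's lemma: \<open>full d\<close>
  for a node awaiting centres, and \<open>leaves b\<close> for a node inside block \<open>b\<close>,
  where \<open>b \<le> d\<close>.\<close>

definition cap :: "nat \<Rightarrow> nat" where
  "cap d = full d + (\<Sum>b\<le>d. leaves b)"

text \<open>Only nodes at a depth \<open>start b\<close>, where a centre comes next, may still lack
  children.\<close>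

definition tree :: "nat list set \<Rightarrow> bool" where
  "tree T \<longleftrightarrow> finite T \<and> [] \<in> T \<and> (\<forall>xs x. xs @ [x] \<in> T \<longrightarrow> xs \<in> T) \<and>
     (\<forall>xs \<in> T. distinct xs \<and> card (children T xs) \<le> cap (length xs) \<and>
        (length xs \<notin> range start \<longrightarrow> full (length xs) \<le> card (children T xs)) \<and>
        (\<forall>b a. a \<le> b \<longrightarrow> start b + a < length xs \<longrightarrow>
           (\<exists>c L. (c, L) \<in> U (b mod k) \<and> xs ! start b = c \<and> (0 < a \<longrightarrow> xs ! (start b + a) \<in> L))))"

definition built :: "nat list set \<Rightarrow> nat set set \<Rightarrow> bool" where
  "built T M \<longleftrightarrow> tree T \<and> (\<forall>xs \<in> T. clique M (set xs))"

definition frontier :: "nat list set \<Rightarrow> nat list set" where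
  "frontier T = {xs \<in> T. length xs \<in> range start \<and> card (children T xs) < full (length xs)}"

text \<open>
  A new vertex must stop at the frontier, so earlier extensions of frontier nodes are cut off.
\<close>

definition trunk :: "nat list set \<Rightarrow> nat list set" where
  "trunk T = {xs \<in> T. \<forall>p x zs. xs = p @ x # zs \<longrightarrow> p \<notin> frontier T}"

definition extendable :: "nat list set \<Rightarrow> nat set set \<Rightarrow> bool" where
  "extendable T M \<longleftrightarrow> (\<exists>y \<in> frontier T. \<exists>b c L Q. length y = start b \<and> (c, L) \<in> U (b mod k) \<and>
     insert c L \<inter> \<Union>(set ` T) = {} \<and> c \<notin> L \<and> finite Q \<and> Q \<subseteq> L \<and> card Q = leaves b \<and>
     clique M (insert c (set y \<union> Q)))"

text \<open>A proper prefix of \<open>xs @ [x]\<close> is \<open>xs\<close> or a proper prefix of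
  \<open>xs\<close>, so a node outside the frontier loses no child.\<close>

lemma wide_trunk:
  assumes "tree T" shows "wide full (frontier T) (trunk T)"
  unfolding wide_def
proof (intro conjI ballI)
  show "[] \<in> trunk T" using assms by (auto simp: tree_def trunk_def)
  fix xs assume xs: "xs \<in> trunk T"
  show "xs \<in> frontier T \<or> full (length xs) \<le> card (children (trunk T) xs)"
  proof (cases "xs \<in> frontier T")
    case False
    have "xs @ [x] \<in> trunk T" if "xs @ [x] \<in> T" for x
      unfolding trunk_def
    proof (intro CollectI conjI that allI impI)
      fix p z zs assume eq: "xs @ [x] = p @ z # zs"
      show "p \<notin> frontier T"
      proof (cases zs rule: rev_cases)
        case Nil
        then show ?thesis using eq False by simp
      next
        case (snoc zs' w)
        then have "xs = p @ z # zs'" using eq by simp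
        then show ?thesis using xs by (auto simp: trunk_def)
      qed
    qed
    then have "children (trunk T) xs = children T xs" by (auto simp: children_def trunk_def)
    then show ?thesis using xs False assms by (auto simp: frontier_def trunk_def tree_def)
  qed simp
qed

lemma trunk_subset: "trunk T \<subseteq> T"
  by (auto simp: trunk_def)

lemma trunk_no_children: "y \<in> frontier T \<Longrightarrow> y @ [x] \<notin> trunk T"
  by (auto simp: trunk_def)

subsection \<open>Processing a component\<close>

definition coloured :: "nat \<Rightarrow> nat list \<Rightarrow> bool" where
  "coloured i y \<longleftrightarrow> (\<exists>b. length y = start b \<and> b mod k = i)"

text \<open>
  While the leaves of \<open>c\<close> are processed, \<open>E\<close> extends \<open>S\<close> below the frontier nodes \<open>y\<close> of colour \<open>i\<close> by nodes
  \<open>y @ zs\<close> with \<open>zs\<close> a list of leaves. The centre \<open>c\<close> is left out of these lists, although it is joined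
  to all their vertices.
\<close>

definition grown :: "nat list set \<Rightarrow> nat list set \<Rightarrow> (nat \<Rightarrow> nat) \<Rightarrow> nat \<Rightarrow> nat \<Rightarrow> nat set \<Rightarrow>
    nat set set \<Rightarrow> nat list set \<Rightarrow> bool" where
  "grown T S \<beta> i c L M E \<longleftrightarrow> finite E \<and> S \<subseteq> E \<and>
     (\<forall>xs \<in> E - S. \<exists>y zs. xs = y @ zs \<and> zs \<noteq> [] \<and> y \<in> S \<inter> frontier T \<and> coloured i y \<and>
        distinct zs \<and> set zs \<subseteq> L \<and> (\<forall>b. length y = start b \<longrightarrow> length zs < leaves b) \<and>
        butlast xs \<in> E \<and> clique M (insert c (set xs))) \<and>
     (\<forall>xs \<in> E. xs \<notin> S \<or> xs \<in> frontier T \<and> coloured i xs \<longrightarrow>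
        card (children E xs) \<le> widen \<beta> (length xs))"

definition max_leaves :: "nat \<Rightarrow> nat" where
  "max_leaves D = (\<Sum>b\<le>D. leaves b)"

text \<open>A crude count below at most \<open>t\<close> frontier nodes, with the sum of
  \<open>widen \<beta>\<close> over all relevant depths as common branching bound;
  \<open>Suc\<close> makes it strict. It does not involve the component.\<close>

definition grow_bound :: "nat \<Rightarrow> nat \<Rightarrow> (nat \<Rightarrow> nat) \<Rightarrow> nat" where
  "grow_bound t D \<beta> = Suc (\<Sum>r\<le>max_leaves D. t * (\<Sum>d\<le>D + max_leaves D. widen \<beta> d) ^ r)"

lemma leaves_le_max: "start b < D \<Longrightarrow> leaves b \<le> max_leaves D"
  using le_start[of b] unfolding max_leaves_def by (intro member_le_sum) auto

text \<open>New nodes are sorted by the number of leaves below their frontier node. Since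
  \<open>L\<close> misses the vertices of \<open>T\<close>, level 0 consists of the frontier nodes
  themselves and every later level lies outside \<open>S\<close>.\<close>

lemma grown_card:
  assumes "grown T S \<beta> i c L M E" and "S \<subseteq> T" and "finite T"
    and "\<And>xs. xs \<in> T \<Longrightarrow> length xs < D" and "L \<inter> \<Union>(set ` T) = {}"
  shows "card (E - S) < grow_bound (card T) D \<beta>"
proof -
  define Y where "Y = {y \<in> S \<inter> frontier T. coloured i y}"
  define C where "C = (\<Sum>d\<le>D + max_leaves D. widen \<beta> d)"
  define X where "X r = {y @ zs |y zs. y \<in> Y \<and> length zs = r \<and> set zs \<subseteq> L \<and> y @ zs \<in> E}" for r
  have finE: "finite E" and SE: "S \<subseteq> E" using assms(1) by (auto simp: grown_def)
  have new: "\<exists>y zs. xs = y @ zs \<and> zs \<noteq> [] \<and> y \<in> Y \<and> set zs \<subseteq> L \<and> length zs < max_leaves D \<and> butlast xs \<in> E"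
    if xs: "xs \<in> E - S" for xs
  proof -
    obtain y zs where y: "xs = y @ zs" "zs \<noteq> []" "y \<in> S \<inter> frontier T" "coloured i y" "set zs \<subseteq> L"
      "\<forall>b. length y = start b \<longrightarrow> length zs < leaves b" "butlast xs \<in> E"
      using assms(1) xs unfolding grown_def by blast
    obtain b where "length y = start b" using y(4) by (auto simp: coloured_def)
    moreover have "length y < D" using y(3) assms(2,4) by auto
    ultimately have "length zs < max_leaves D" using y(6) leaves_le_max[of b D] by fastforce
    then show ?thesis using y by (auto simp: Y_def)
  qed
  have old: "zs = []" if "y @ zs \<in> T" "set zs \<subseteq> L" for y zs
    using that assms(5) by (cases zs) fastforce+
  have YS: "X 0 = Y" using SE by (auto simp: X_def Y_def)
  have YT: "Y \<subseteq> T" using assms(2) by (auto simp: Y_def)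
  have lvl: "finite (X r) \<and> card (X r) \<le> card (X 0) * C ^ r" for r
  proof (rule card_children_tree_le[of E X C r])
    show "finite E" "finite (X 0)" using finE YS YT assms(3) finite_subset by auto
    show "\<exists>p \<in> X r. \<exists>x \<in> children E p. xs = p @ [x]" if xs: "xs \<in> X (Suc r)" for r xs
    proof -
      obtain y zs where y: "xs = y @ zs" "y \<in> Y" "length zs = Suc r" "set zs \<subseteq> L" "xs \<in> E"
        using xs by (auto simp: X_def)
      then have "xs \<in> E - S" using old[of y zs] assms(2) by auto
      then have "butlast xs \<in> E" using new by blast
      moreover obtain zs' x where zs: "zs = zs' @ [x]" using y(3) by (cases zs rule: rev_cases) auto
      ultimately have "y @ zs' \<in> X r" using y by (auto simp: X_def butlast_append)
      then show ?thesis using y zs by (intro bexI[of _ "y @ zs'"] bexI[of _ x]) (auto simp: children_def)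
    qed
    show "card (children E p) \<le> C" if p: "p \<in> X r" for r p
    proof -
      obtain y zs where y: "p = y @ zs" "y \<in> Y" "length zs = r" "set zs \<subseteq> L" "p \<in> E"
        using p by (auto simp: X_def)
      have "length p \<le> D + max_leaves D \<and> (p \<notin> S \<or> p \<in> Y)"
      proof (cases "p \<in> S")
        case True
        then have "p \<in> T" using assms(2) by auto
        then have "length p < D" using assms(4) by auto
        moreover have "zs = []" using old[of y zs] y True assms(2) by auto
        ultimately show ?thesis using y by auto
      next
        case False
        then obtain y' zs' where "p = y' @ zs'" "y' \<in> Y" "length zs' < max_leaves D"
          using new[of p] y by auto
        then show ?thesis using False YT assms(4)[of y'] by auto
      qed
      moreover from this have "card (children E p) \<le> widen \<beta> (length p)"
        using assms(1) y(5) unfolding grown_def Y_def by auto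
      moreover have "widen \<beta> d \<le> C" if "d \<le> D + max_leaves D" for d
        unfolding C_def using that by (intro member_le_sum) auto
      ultimately show ?thesis by (meson order_trans)
    qed
  qed
  have "E - S \<subseteq> (\<Union>r\<le>max_leaves D. X r)"
  proof
    fix xs assume xs: "xs \<in> E - S"
    then obtain y zs where "xs = y @ zs" "y \<in> Y" "set zs \<subseteq> L" "length zs < max_leaves D"
      using new by blast
    then have "xs \<in> X (length zs)" "length zs \<le> max_leaves D" using xs by (auto simp: X_def)
    then show "xs \<in> (\<Union>r\<le>max_leaves D. X r)" by blast
  qed
  then have "card (E - S) \<le> card (\<Union>r\<le>max_leaves D. X r)" using lvl by (intro card_mono) auto
  also have "\<dots> \<le> (\<Sum>r\<le>max_leaves D. card (X r))" by (rule card_UN_le) simp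
  also have "\<dots> \<le> (\<Sum>r\<le>max_leaves D. card T * C ^ r)"
  proof (rule sum_mono)
    fix r
    have "card (X 0) \<le> card T" unfolding YS using YT assms(3) by (rule card_mono[rotated])
    then show "card (X r) \<le> card T * C ^ r" using lvl[of r] by (meson mult_le_mono1 order_trans)
  qed
  finally show ?thesis by (simp add: grow_bound_def C_def)
qed

text \<open>Colour \<open>i\<close> is disposed of: the remaining colours can be treated inside
  \<open>Z\<close>.\<close>

definition avoids :: "nat list set \<Rightarrow> nat list set \<Rightarrow> (nat \<Rightarrow> nat) \<Rightarrow> nat \<Rightarrow> bool" where
  "avoids T S \<beta> i \<longleftrightarrow> (\<exists>Z \<subseteq> S. wide \<beta> (frontier T) Z \<and> (\<forall>y \<in> Z \<inter> frontier T. \<not> coloured i y))"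

text \<open>One move joins the leaf to its centre; the others attach it to \<open>E\<close>, whose
  nodes have length at most \<open>D + max_leaves D\<close>.\<close>

definition grow_moves :: "(nat \<Rightarrow> nat) \<Rightarrow> nat \<Rightarrow> nat" where
  "grow_moves \<beta> D = Suc (tree_size \<beta> (Suc (D + max_leaves D)))"

text \<open>The leaf is attached to \<open>E\<close>, where a node with room for another child
  counts as a stopping place. Either the subtree it reaches avoids colour \<open>i\<close>, or it
  contains such a node, and the leaf prolongs the list of leaves there.\<close>

lemma force_leaf:
  assumes T: "built T M" "\<And>xs. xs \<in> T \<Longrightarrow> length xs < D"
    and S: "S \<subseteq> trunk T" "wide (widen \<beta>) (frontier T) S" "\<And>xs x. xs \<in> S \<Longrightarrow> x \<in> set xs \<Longrightarrow> {c, x} \<in> M"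
    and \<beta>: "\<And>d. 1 \<le> \<beta> d"
    and U: "(c, L) \<in> U i" "finite L" "c \<notin> L" "insert c L \<inter> \<Union>(set ` T) = {}"
    and pos: "position M B" and E: "grown T S \<beta> i c L M E"
    and l: "l \<in> L" "l \<notin> touched M B"
  shows "force (grow_moves \<beta> D) (\<lambda>M' B'. extendable T M' \<or> avoids T S \<beta> i \<or>
    (\<exists>E'. grown T S \<beta> i c L M' E' \<and> card (E' - S) = Suc (card (E - S)))) M B"
  unfolding grow_moves_def
proof (rule force_claim[OF _ pos])
  have ST: "S \<subseteq> T" using S(1) trunk_subset by auto
  have finE: "finite E" and SE: "S \<subseteq> E" using E by (auto simp: grown_def)
  have new: "\<exists>y zs. xs = y @ zs \<and> zs \<noteq> [] \<and> y \<in> S \<inter> frontier T \<and> coloured i y \<and>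
        distinct zs \<and> set zs \<subseteq> L \<and> (\<forall>b. length y = start b \<longrightarrow> length zs < leaves b) \<and>
        butlast xs \<in> E \<and> clique M (insert c (set xs))" if "xs \<in> E - S" for xs
    using E that unfolding grown_def by blast
  have cliq: "clique M (insert c (set xs))" if "xs \<in> E" for xs
  proof (cases "xs \<in> S")
    case True
    then show ?thesis using T(1) ST S(3) by (auto simp: clique_insert built_def)
  next
    case False
    then show ?thesis using new[of xs] that by blast
  qed
  have lc: "l \<noteq> c" using l U by auto
  then show "{l, c} \<in> edges K_aleph0 - M - B" using l by (auto simp: touched_def)
  \<comment> \<open>Every vertex other than \<open>c\<close> on a path in \<open>E\<close> is joined
    to \<open>c\<close> by Maker, whereas \<open>l\<close> is untouched.\<close>
  have lE: "l \<notin> set xs" if "xs \<in> E" for xs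
  proof
    assume "l \<in> set xs"
    then have "{c, l} \<in> M" using cliq[OF that] lc by (auto simp: clique_insert)
    then show False using l(2) by (auto simp: touched_def)
  qed
  have lenE: "length xs < Suc (D + max_leaves D)" if xs: "xs \<in> E" for xs
  proof (cases "xs \<in> S")
    case True then show ?thesis using T(2) ST by fastforce
  next
    case False
    then obtain y zs b where y: "xs = y @ zs" "y \<in> S" "length y = start b" "length zs < leaves b"
      using new[of xs] xs unfolding coloured_def by blast
    have "y \<in> T" using y ST by auto
    then have "length y < D" by (rule T(2))
    then show ?thesis using y leaves_le_max[of b D] by auto
  qed
  define grow where "grow xs \<longleftrightarrow> xs \<in> E \<and> (xs \<notin> S \<or> xs \<in> frontier T \<and> coloured i xs)" for xs
  \<comment> \<open>This choice makes \<open>E\<close> wide: a growing node outside \<open>F\<close>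
    already has \<open>widen \<beta>\<close> children, and any other node keeps its children from
    \<open>S\<close>.\<close>
  define F where "F = (frontier T - {y. coloured i y}) \<inter> S \<union> {xs. grow xs \<and> card (children E xs) < widen \<beta> (length xs)}"
  have wE: "wide (widen \<beta>) F E"
    unfolding wide_def
  proof (intro conjI ballI)
    show "[] \<in> E" using S(2) SE by (auto simp: wide_def)
    fix xs assume xs: "xs \<in> E"
    show "xs \<in> F \<or> widen \<beta> (length xs) \<le> card (children E xs)"
    proof (cases "grow xs")
      case False
      then have "xs \<in> S" "\<not> (xs \<in> frontier T \<and> coloured i xs)" using xs by (auto simp: grow_def)
      then show ?thesis using S(2) card_children_mono[OF SE finE, of xs] by (auto simp: F_def wide_def)
    qed (auto simp: F_def)
  qed
  fix M1 B1 assume r1: "reach 1 M B M1 B1" and lM: "{l, c} \<in> M1"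
  \<comment> \<open>The reply to \<open>{l, c}\<close> is the one edge that the \<open>Suc\<close>
    in \<open>widen\<close> allows for.\<close>
  have "kill B1 l \<le> 1" using kill_reach[OF r1, of l] kill_untouched[OF l(2)] by simp
  then have "force (tree_size \<beta> (Suc (D + max_leaves D))) (\<lambda>M' B'. \<exists>Z \<subseteq> E. wide \<beta> F Z \<and>
      (\<forall>xs \<in> Z. \<forall>x \<in> set xs. {l, x} \<in> M')) M1 B1"
    using r1 finE wE lE lenE by (intro force_attach) (auto simp: reach_def)
  then show "force (tree_size \<beta> (Suc (D + max_leaves D))) (\<lambda>M' B'. extendable T M' \<or> avoids T S \<beta> i \<or>
    (\<exists>E'. grown T S \<beta> i c L M' E' \<and> card (E' - S) = Suc (card (E - S)))) M1 B1"
  proof (rule force_conseq)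
    show "position M1 B1" using r1 by (simp add: reach_def)
    fix M2 B2 assume r2: "reach (tree_size \<beta> (Suc (D + max_leaves D))) M1 B1 M2 B2"
      and "\<exists>Z \<subseteq> E. wide \<beta> F Z \<and> (\<forall>xs \<in> Z. \<forall>x \<in> set xs. {l, x} \<in> M2)"
    then obtain Z where Z: "Z \<subseteq> E" "wide \<beta> F Z" "\<And>xs x. xs \<in> Z \<Longrightarrow> x \<in> set xs \<Longrightarrow> {l, x} \<in> M2" by blast
    have MM: "M \<subseteq> M2" "{l, c} \<in> M2" using r1 r2 lM by (auto simp: reach_def)
    have finZ: "finite Z" using Z(1) finE by (rule finite_subset)
    show "extendable T M2 \<or> avoids T S \<beta> i \<or>
      (\<exists>E'. grown T S \<beta> i c L M2 E' \<and> card (E' - S) = Suc (card (E - S)))"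
    proof (cases "\<exists>xs \<in> Z. grow xs")
      case False
      then have "Z \<subseteq> S" using Z(1) by (auto simp: grow_def)
      moreover have "wide \<beta> (frontier T) Z" using Z(2) False by (auto simp: wide_def F_def)
      moreover have "\<not> coloured i y" if "y \<in> Z \<inter> frontier T" for y using that False Z(1) by (auto simp: grow_def)
      ultimately show ?thesis by (auto simp: avoids_def)
    next
      case True
      then obtain xs0 where xs0: "xs0 \<in> Z" "grow xs0" by blast
      \<comment> \<open>A child cannot fall back into \<open>S\<close>: the trunk ends at frontier
        nodes, and nodes of \<open>T\<close> contain no vertex of \<open>L\<close>.\<close>
      have step: "grow (ys @ [x])" if step: "ys \<in> Z" "grow ys" "ys @ [x] \<in> Z" for ys x
      proof -
        have "ys @ [x] \<notin> S"
        proof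
          assume a: "ys @ [x] \<in> S"
          show False
          proof (cases "ys \<in> S")
            case True
            then have "ys \<in> frontier T" using that(2) by (auto simp: grow_def)
            then show False using a S(1) trunk_no_children by blast
          next
            case False
            then obtain y zs where "ys = y @ zs" "zs \<noteq> []" "set zs \<subseteq> L" using new[of ys] step Z(1) by blast
            then have "hd zs \<in> L \<and> hd zs \<in> set (ys @ [x])" by auto
            then show False using a ST U(4) by blast
          qed
        qed
        then show ?thesis using that Z(1) by (auto simp: grow_def)
      qed
      obtain ys where ys: "ys \<in> Z" "ys \<in> F" "grow ys"
        using wide_frontier[OF finZ Z(2) \<beta> xs0(1), of grow] xs0(2) step by blast
      \<comment> \<open>This room keeps the branching bound of \<open>grown\<close> valid when
        \<open>l\<close> becomes a child of \<open>ys\<close>.\<close>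
      have few: "card (children E ys) < widen \<beta> (length ys)" using ys by (auto simp: F_def grow_def)
      have ysE: "ys \<in> E" using ys Z(1) by auto
      obtain y zs where y: "ys = y @ zs" "y \<in> S \<inter> frontier T" "coloured i y" "distinct zs" "set zs \<subseteq> L"
        "\<forall>b. length y = start b \<longrightarrow> length zs < leaves b \<or> zs = []"
      proof (cases "ys \<in> S")
        case True
        then show ?thesis using ys(3) by (intro that[of ys "[]"]) (auto simp: grow_def)
      next
        case False
        then have "ys \<in> E - S" using ysE by simp
        from new[OF this] show ?thesis using that by blast
      qed
      have cl: "clique M2 (insert c (set (ys @ [l])))"
      proof -
        have "clique M2 (insert c (set ys))" using cliq[OF ysE] MM(1) by (rule clique_mono) simp
        then have "clique M2 (insert l (insert c (set ys)))"
          using Z(3)[OF ys(1)] MM(2) by (subst clique_insert) auto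
        then show ?thesis by (simp add: insert_commute)
      qed
      obtain b where b: "length y = start b" "b mod k = i" using y(3) by (auto simp: coloured_def)
      show ?thesis
      proof (cases "leaves b \<le> Suc (length zs)")
        case True
        have dz: "distinct (zs @ [l])" using y(1,4) lE[OF ysE] by auto
        obtain Q where Q: "Q \<subseteq> set (zs @ [l])" "card Q = leaves b"
          using obtain_subset_with_card_n[of "leaves b" "set (zs @ [l])"] True distinct_card[OF dz] by auto
        have "clique M2 (insert c (set y \<union> Q))"
          by (rule clique_mono[OF cl]) (use Q(1) y(1) in auto)
        moreover have "finite Q" "Q \<subseteq> L" using Q(1) y(5) l(1) finite_subset[OF Q(1)] by auto
        ultimately have "extendable T M2"
          unfolding extendable_def using y(2) b Q(2) U by (intro bexI[of _ y]) blast+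
        then show ?thesis by simp
      next
        case False
        define E' where "E' = insert (ys @ [l]) E"
        have nE: "ys @ [l] \<notin> E" using lE by fastforce
        have ch: "children E' xs = (if xs = ys then insert l (children E xs) else children E xs)" for xs
          by (auto simp: E'_def children_def)
        have "grown T S \<beta> i c L M2 E'"
          unfolding grown_def
        proof (intro conjI ballI impI)
          show "finite E'" "S \<subseteq> E'" using finE SE by (auto simp: E'_def)
          show "\<exists>y zs. xs = y @ zs \<and> zs \<noteq> [] \<and> y \<in> S \<inter> frontier T \<and> coloured i y \<and>
            distinct zs \<and> set zs \<subseteq> L \<and> (\<forall>b. length y = start b \<longrightarrow> length zs < leaves b) \<and>
            butlast xs \<in> E' \<and> clique M2 (insert c (set xs))" if "xs \<in> E' - S" for xs
          proof (cases "xs = ys @ [l]")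
            case True
            then show ?thesis
              using y b False l(1) lE[OF ysE] ysE cl
              by - (rule exI[of _ y], rule exI[of _ "zs @ [l]"], auto simp: E'_def butlast_append)
          next
            case F: False
            then have "xs \<in> E - S" using that by (auto simp: E'_def)
            from new[OF this] show ?thesis
              using clique_mono[OF _ MM(1) order_refl] unfolding E'_def by (metis insertCI)
          qed
          show "card (children E' xs) \<le> widen \<beta> (length xs)"
            if "xs \<in> E'" "xs \<notin> S \<or> xs \<in> frontier T \<and> coloured i xs" for xs
          proof (cases "xs \<in> E")
            case True
            then have "card (children E xs) \<le> widen \<beta> (length xs)" using E that by (auto simp: grown_def)
            then show ?thesis using few finE by (auto simp: ch card_insert_if)
          next
            case False
            then have "xs = ys @ [l]" using that by (simp add: E'_def)
            moreover have "children E (ys @ [l]) = {}" using lE by (fastforce simp: children_def)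
            ultimately show ?thesis by (simp add: ch)
          qed
        qed
        moreover have "E' - S = insert (ys @ [l]) (E - S)" using nE SE by (auto simp: E'_def)
        then have "card (E' - S) = Suc (card (E - S))" using nE finE by simp
        ultimately show ?thesis by blast
      qed
    qed
  qed
qed

lemma built_mono: "built T M \<Longrightarrow> M \<subseteq> M' \<Longrightarrow> built T M'"
  unfolding built_def by (meson clique_mono order_refl)

text \<open>\<open>j\<close> counts the leaves that may still be needed: each unsuccessful one adds
  a node to \<open>E\<close>, and \<open>j = 0\<close> contradicts \<open>grown_card\<close>. The
  last hypothesis reserves the vertices of \<open>L\<close> that the remaining rounds may
  touch.\<close>

lemma force_grow:
  assumes len: "\<And>xs. xs \<in> T \<Longrightarrow> length xs < D"
    and S: "S \<subseteq> trunk T" "wide (widen \<beta>) (frontier T) S" and \<beta>: "\<And>d. 1 \<le> \<beta> d"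
    and U: "(c, L) \<in> U i" "finite L" "c \<notin> L" "insert c L \<inter> \<Union>(set ` T) = {}"
    and "built T M" "\<And>xs x. xs \<in> S \<Longrightarrow> x \<in> set xs \<Longrightarrow> {c, x} \<in> M"
    and "position M B" "grown T S \<beta> i c L M E"
    and "grow_bound (card T) D \<beta> \<le> card (E - S) + j"
    and "card (L \<inter> touched M B) + 4 * (j * grow_moves \<beta> D) < card L"
  shows "force (j * grow_moves \<beta> D) (\<lambda>M' B'. extendable T M' \<or> avoids T S \<beta> i) M B"
  using assms(9-)
proof (induction j arbitrary: M B E)
  case 0
  have "card (E - S) < grow_bound (card T) D \<beta>"
    using 0 order_trans[OF S(1) trunk_subset] len U(4)
    by (intro grown_card[of T S \<beta> i c L M E]) (auto simp: built_def tree_def)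
  then show ?case using 0 by simp
next
  case (Suc j)
  have "\<exists>l \<in> L. l \<notin> touched M B"
  proof (rule ccontr)
    assume "\<not> ?thesis"
    then have "L \<inter> touched M B = L" by auto
    then show False using Suc.prems(6) by simp
  qed
  then obtain l where l: "l \<in> L" "l \<notin> touched M B" by auto
  have "force (grow_moves \<beta> D + j * grow_moves \<beta> D) (\<lambda>M' B'. extendable T M' \<or> avoids T S \<beta> i) M B"
  proof (rule force_bind[OF force_leaf[OF Suc.prems(1) len S Suc.prems(2) \<beta> U Suc.prems(3,4) l] Suc.prems(3)])
    fix M' B' assume r: "reach (grow_moves \<beta> D) M B M' B'" and
      "extendable T M' \<or> avoids T S \<beta> i \<or>
        (\<exists>E'. grown T S \<beta> i c L M' E' \<and> card (E' - S) = Suc (card (E - S)))"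
    then consider "extendable T M' \<or> avoids T S \<beta> i"
      | E' where "grown T S \<beta> i c L M' E'" "card (E' - S) = Suc (card (E - S))" by blast
    then show "force (j * grow_moves \<beta> D) (\<lambda>M' B'. extendable T M' \<or> avoids T S \<beta> i) M' B'"
    proof cases
      case 1
      then show ?thesis by (intro force_here)
    next
      case 2
      have MM: "M \<subseteq> M'" "position M' B'" using r by (auto simp: reach_def)
      show ?thesis
      proof (rule Suc.IH[of M' B' E'])
        show "built T M'" using Suc.prems(1) MM(1) by (rule built_mono)
        show "{c, x} \<in> M'" if "xs \<in> S" "x \<in> set xs" for xs x using Suc.prems(2)[OF that] MM by auto
        show "card (L \<inter> touched M' B') + 4 * (j * grow_moves \<beta> D) < card L"
          using touched_reach[OF r U(2)] Suc.prems(6) by (simp add: algebra_simps)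
      qed (use 2 MM Suc.prems(5) in auto)
    qed
  qed auto
  then show ?case by simp
qed

definition colour_moves :: "(nat \<Rightarrow> nat) \<Rightarrow> nat \<Rightarrow> nat \<Rightarrow> nat" where
  "colour_moves \<beta> D t = tree_size (widen \<beta>) D + grow_bound t D \<beta> * grow_moves \<beta> D"

text \<open>The number of moves is known from \<open>\<beta>\<close>, \<open>D\<close> and
  \<open>card T\<close>, so a component with more than four times as many leaves can be picked, away
  from \<open>T\<close> and from all touched vertices.\<close>

lemma force_colour:
  assumes T: "built T M" "\<And>xs. xs \<in> T \<Longrightarrow> length xs < D"
    and S: "S \<subseteq> trunk T" "wide (widen (widen \<beta>)) (frontier T) S"
    and \<beta>: "\<And>d. 1 \<le> \<beta> d" and pos: "position M B" and "i < k"
  shows "force (colour_moves \<beta> D (card T)) (\<lambda>M' B'. extendable T M' \<or> avoids T S \<beta> i) M B"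
proof -
  have finT: "finite T" using T by (simp add: built_def tree_def)
  have ST: "S \<subseteq> T" using S(1) trunk_subset by auto
  obtain c L where U: "(c, L) \<in> U i" "finite L" "c \<notin> L" "Suc (4 * colour_moves \<beta> D (card T)) \<le> card L"
    "insert c L \<inter> (touched M B \<union> \<Union>(set ` T)) = {}"
    using fresh_unit[OF \<open>i < k\<close>, of "touched M B \<union> \<Union>(set ` T)"] finite_touched[OF pos] finT by blast
  have "force (tree_size (widen \<beta>) D) (\<lambda>M' B'. \<exists>Z \<subseteq> S. wide (widen \<beta>) (frontier T) Z \<and>
      (\<forall>xs \<in> Z. \<forall>x \<in> set xs. {c, x} \<in> M')) M B"
  proof (rule force_attach[OF pos _ S(2)])
    show "finite S" using finT ST finite_subset by blast
    show "kill B c \<le> 1" using kill_untouched[of c M B] U(5) by auto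
    show "c \<notin> set xs" "length xs < D" if "xs \<in> S" for xs using that ST U(5) T(2) by auto
  qed
  then show ?thesis unfolding colour_moves_def
  proof (rule force_bind[OF _ pos])
    fix M' B' assume r: "reach (tree_size (widen \<beta>) D) M B M' B'"
      and "\<exists>Z \<subseteq> S. wide (widen \<beta>) (frontier T) Z \<and> (\<forall>xs \<in> Z. \<forall>x \<in> set xs. {c, x} \<in> M')"
    then obtain Z where Z: "Z \<subseteq> S" "wide (widen \<beta>) (frontier T) Z"
      "\<And>xs x. xs \<in> Z \<Longrightarrow> x \<in> set xs \<Longrightarrow> {c, x} \<in> M'" by blast
    have "force (grow_bound (card T) D \<beta> * grow_moves \<beta> D) (\<lambda>M' B'. extendable T M' \<or> avoids T Z \<beta> i) M' B'"
    proof (rule force_grow[OF T(2) _ Z(2) \<beta> U(1-3), where E = Z])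
      have "children Z y = {}" if "y \<in> frontier T" for y
        using trunk_no_children[OF that] Z(1) S(1) by (auto simp: children_def)
      then show "grown T Z \<beta> i c L M' Z"
        using finite_subset[OF order_trans[OF Z(1) ST] finT] by (auto simp: grown_def)
      have "L \<inter> touched M B = {}" using U(5) by auto
      then show "card (L \<inter> touched M' B') + 4 * (grow_bound (card T) D \<beta> * grow_moves \<beta> D) < card L"
        using touched_reach[OF r U(2)] U(4) by (simp add: colour_moves_def)
      show "built T M'" using T(1) r by (auto intro: built_mono simp: reach_def)
    qed (use U Z S r in \<open>auto simp: reach_def\<close>)
    then show "force (grow_bound (card T) D \<beta> * grow_moves \<beta> D) (\<lambda>M' B'. extendable T M' \<or> avoids T S \<beta> i) M' B'"
    proof (rule force_conseq)
      show "position M' B'" using r by (simp add: reach_def)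
      show "extendable T M'' \<or> avoids T S \<beta> i" if "extendable T M'' \<or> avoids T Z \<beta> i" for M''
        using that Z(1) unfolding avoids_def by (meson order_trans)
    qed
  qed
qed

text \<open>Induction on the number of colours that frontier nodes in \<open>S\<close> may still
  have; the step removes colour \<open>j\<close>. With no colour left there is no frontier node,
  contrary to \<open>wide_frontier\<close>. That \<open>N\<close> depends on \<open>T\<close> alone
  is what \<open>strategy_of_stages\<close> requires.\<close>

lemma force_extendable:
  assumes "tree T"
  shows "\<exists>N. \<forall>M B. position M B \<longrightarrow> built T M \<longrightarrow> force N (\<lambda>M' B'. extendable T M') M B"
proof -
  define D where "D = Suc (Max (length ` T))"
  have finT: "finite T" using assms by (simp add: tree_def)
  have len: "length xs < D" if "xs \<in> T" for xs
    unfolding D_def using finT that by (simp add: le_imp_less_Suc)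
  have "\<exists>N. \<forall>S M B. position M B \<longrightarrow> built T M \<longrightarrow> S \<subseteq> trunk T \<longrightarrow> wide (width (2 * j)) (frontier T) S \<longrightarrow>
    (\<forall>y \<in> S \<inter> frontier T. \<exists>i<j. coloured i y) \<longrightarrow> force N (\<lambda>M' B'. extendable T M') M B" if "j \<le> k" for j
    using that
  proof (induction j)
    case 0
    have False if "S \<subseteq> trunk T" "wide (width 0) (frontier T) S" "\<forall>y \<in> S \<inter> frontier T. \<exists>i<0. coloured i y" for S
    proof -
      have "finite S" using that(1) trunk_subset finT by (meson finite_subset)
      then have "\<exists>ys \<in> S \<inter> frontier T. True"
        by (rule wide_frontier[OF _ that(2) width_pos]) (use that(2) in \<open>auto simp: wide_def\<close>)
      then show False using that(3) by auto
    qed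
    then show ?case by (metis mult_0_right)
  next
    case (Suc j)
    then obtain N where N: "\<And>S M B. \<lbrakk>position M B; built T M; S \<subseteq> trunk T; wide (width (2 * j)) (frontier T) S;
      \<forall>y \<in> S \<inter> frontier T. \<exists>i<j. coloured i y\<rbrakk> \<Longrightarrow> force N (\<lambda>M' B'. extendable T M') M B" by (auto simp del: One_nat_def)
    have w: "width (2 * Suc j) = widen (widen (width (2 * j)))" by (simp add: width_def)
    show ?case
    proof (intro exI allI impI)
      fix S M B assume pos: "position M B" and T: "built T M" and S: "S \<subseteq> trunk T"
        "wide (width (2 * Suc j)) (frontier T) S" "\<forall>y \<in> S \<inter> frontier T. \<exists>i<Suc j. coloured i y"
      have "force (colour_moves (width (2 * j)) D (card T))
        (\<lambda>M' B'. extendable T M' \<or> avoids T S (width (2 * j)) j) M B"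
        using Suc.prems S(2) unfolding w by (intro force_colour[OF T len S(1)] width_pos pos) auto
      then show "force (colour_moves (width (2 * j)) D (card T) + N) (\<lambda>M' B'. extendable T M') M B"
      proof (rule force_bind[OF _ pos])
        fix M' B' assume r: "reach (colour_moves (width (2 * j)) D (card T)) M B M' B'"
          and "extendable T M' \<or> avoids T S (width (2 * j)) j"
        then consider "extendable T M'"
          | Z where "Z \<subseteq> S" "wide (width (2 * j)) (frontier T) Z" "\<forall>y \<in> Z \<inter> frontier T. \<not> coloured j y"
          by (auto simp: avoids_def)
        then show "force N (\<lambda>M' B'. extendable T M') M' B'"
        proof cases
          case 1
          then show ?thesis by (rule force_here)
        next
          case 2
          show ?thesis
          proof (rule N)
            show "\<forall>y \<in> Z \<inter> frontier T. \<exists>i<j. coloured i y"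
              using 2 S(3) by (metis IntD1 IntD2 IntI less_Suc_eq subsetD)
          qed (use 2 S r T in \<open>auto simp: reach_def intro: built_mono\<close>)
        qed
      qed
    qed
  qed
  from this[of k] obtain N where N: "\<And>S M B. \<lbrakk>position M B; built T M; S \<subseteq> trunk T; wide full (frontier T) S;
      \<forall>y \<in> S \<inter> frontier T. \<exists>i<k. coloured i y\<rbrakk> \<Longrightarrow> force N (\<lambda>M' B'. extendable T M') M B" by auto
  have "\<forall>y \<in> trunk T \<inter> frontier T. \<exists>i<k. coloured i y"
    using k_pos by (auto simp: frontier_def coloured_def)
  then show ?thesis using N[OF _ _ order_refl wide_trunk[OF assms]] by blast
qed

text \<open>Every list of at most \<open>b\<close> distinct elements of \<open>Q\<close> continues
  \<open>y @ [c]\<close>, and all these paths lie in one clique. Those with \<open>b\<close> leaves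
  have length \<open>start (Suc b)\<close> and await the next centre.\<close>

lemma extendable_step:
  assumes T: "built T M" and "extendable T M"
  shows "\<exists>T'. T \<subset> T' \<and> built T' M"
proof -
  obtain y b c L Q where y: "y \<in> frontier T" "length y = start b" and U: "(c, L) \<in> U (b mod k)"
    "insert c L \<inter> \<Union>(set ` T) = {}" "c \<notin> L"
    and Q: "finite Q" "Q \<subseteq> L" "card Q = leaves b" "clique M (insert c (set y \<union> Q))"
    using assms(2) by (auto simp: extendable_def)
  have tT: "tree T" using T by (simp add: built_def)
  have yT: "y \<in> T" "card (children T y) < full (length y)" using y by (auto simp: frontier_def)
  define N where "N = {y @ c # zs |zs. distinct zs \<and> set zs \<subseteq> Q \<and> length zs \<le> b}"
  define T' where "T' = T \<union> N"
  have cT: "c \<notin> set xs" if "xs \<in> T" for xs using that U(2) by auto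
  have QT: "Q \<inter> set xs = {}" if "xs \<in> T" for xs using that U(2) Q(2) by auto
  have NT: "xs \<notin> T" if "xs \<in> N" for xs using that cT by (fastforce simp: N_def)
  have "N \<subseteq> (\<lambda>zs. y @ c # zs) ` {zs. set zs \<subseteq> Q \<and> length zs \<le> b}" by (auto simp: N_def)
  then have finN: "finite N" using finite_lists_length_le[OF Q(1), of b] by (meson finite_imageI finite_subset)
  have chT: "children T' xs = (if xs = y then insert c (children T xs) else children T xs)" if "xs \<in> T" for xs
  proof -
    have "xs @ [x] \<in> N \<longleftrightarrow> xs = y \<and> x = c" for x
    proof
      assume "xs @ [x] \<in> N"
      then obtain zs where zs: "xs @ [x] = y @ c # zs" by (auto simp: N_def)
      have "zs = []"
      proof (rule ccontr)
        assume "zs \<noteq> []"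
        then have "xs = y @ c # butlast zs" using arg_cong[OF zs, of butlast] by (simp add: butlast_append)
        then show False using cT[OF that] by auto
      qed
      then show "xs = y \<and> x = c" using zs by simp
    qed (auto simp: N_def)
    then show ?thesis by (auto simp: children_def T'_def)
  qed
  have chN: "children T' (y @ c # zs) = (if length zs < b then Q - set zs else {})"
    if "distinct zs" "set zs \<subseteq> Q" "length zs \<le> b" for zs
  proof -
    have "(y @ c # zs) @ [x] \<notin> T" for x using cT by fastforce
    moreover have "(y @ c # zs) @ [x] \<in> N \<longleftrightarrow> length zs < b \<and> x \<in> Q - set zs" for x
      using that by (auto simp: N_def)
    ultimately show ?thesis by (auto simp: children_def T'_def)
  qed
  \<comment> \<open>After the centre and \<open>r\<close> leaves the depth is
    \<open>start b + Suc r \<le> start b + b\<close>, so this value is a summand of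
    \<open>leaves b\<close>.\<close>
  have full_le: "full (start b + Suc r) \<le> leaves b - r" if "r < b" for r
  proof -
    have "full (start b + Suc r) \<le> (\<Sum>d\<le>start b + b. full d)" using that by (intro member_le_sum) auto
    then show ?thesis using that by (simp add: leaves_def)
  qed
  have "tree T'"
    unfolding tree_def
  proof (intro conjI allI impI ballI)
    show "finite T'" "[] \<in> T'" using tT finN by (auto simp: T'_def tree_def)
    show "xs \<in> T'" if xs: "xs @ [x] \<in> T'" for xs x
    proof (cases "xs @ [x] \<in> T")
      case True
      then show ?thesis using tT by (auto simp: T'_def tree_def)
    next
      case False
      then obtain zs where zs: "xs @ [x] = y @ c # zs" "distinct zs" "set zs \<subseteq> Q" "length zs \<le> b"
        using xs by (auto simp: T'_def N_def)
      show ?thesis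
      proof (cases zs rule: rev_cases)
        case Nil
        then show ?thesis using zs yT by (simp add: T'_def)
      next
        case (snoc zs' z)
        then have "xs = y @ c # zs'" using zs by simp
        then show ?thesis using zs snoc by (auto simp: T'_def N_def)
      qed
    qed
    fix xs assume xs: "xs \<in> T'"
    consider "xs \<in> T" | zs where "xs = y @ c # zs" "distinct zs" "set zs \<subseteq> Q" "length zs \<le> b"
      using xs by (auto simp: T'_def N_def)
    note cases = this
    show "distinct xs"
      using cases
    proof cases
      case 2
      then show ?thesis using cT[OF yT(1)] QT[OF yT(1)] yT(1) tT U(3) Q(2) by (auto simp: tree_def)
    qed (use tT in \<open>auto simp: tree_def\<close>)
    show "card (children T' xs) \<le> cap (length xs)"
      using cases
    proof cases
      case 1
      have "card (children T xs) \<le> cap (length xs)" using 1 tT by (auto simp: tree_def)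
      moreover have "full (length y) \<le> cap (length y)" by (simp add: cap_def)
      moreover have "card (insert c (children T y)) \<le> Suc (card (children T y))" by (rule card_insert_le_m1) auto
      ultimately show ?thesis using chT[OF 1] yT(2) by auto
    next
      case 2
      have "card (children T' xs) \<le> leaves b"
        using chN[OF 2(2-4)] 2(1) card_mono[OF Q(1), of "Q - set zs"] Q(3) by auto
      also have "\<dots> \<le> (\<Sum>b\<le>length xs. leaves b)"
        using 2(1) y(2) le_start[of b] by (intro member_le_sum) auto
      finally show ?thesis by (simp add: cap_def)
    qed
    show "full (length xs) \<le> card (children T' xs)" if "length xs \<notin> range start"
      using cases
    proof cases
      case 1
      then show ?thesis using that tT chT[OF 1] y(2) by (auto simp: tree_def)
    next
      case 2
      have "length zs \<noteq> b"
      proof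
        assume "length zs = b"
        then have "length xs = start (Suc b)" using 2 y(2) by simp
        then show False using that by blast
      qed
      then have "length zs < b" using 2 by simp
      moreover have "card (Q - set zs) = leaves b - length zs"
        using 2 Q by (simp add: card_Diff_subset distinct_card finite_subset)
      ultimately show ?thesis using chN[OF 2(2-4)] 2(1) full_le[of "length zs"] y(2) by simp
    qed
    show "\<exists>c L. (c, L) \<in> U (b' mod k) \<and> xs ! start b' = c \<and> (0 < a \<longrightarrow> xs ! (start b' + a) \<in> L)"
      if a: "a \<le> b'" "start b' + a < length xs" for b' a
      using cases
    proof cases
      case 1
      then show ?thesis using a tT unfolding tree_def by blast
    next
      case 2
      show ?thesis
      proof (cases "start b' + a < start b")
        case True
        then have "\<exists>c L. (c, L) \<in> U (b' mod k) \<and> y ! start b' = c \<and> (0 < a \<longrightarrow> y ! (start b' + a) \<in> L)"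
          using a yT(1) tT y(2) unfolding tree_def by metis
        then show ?thesis using True 2(1) y(2) by (simp add: nth_append)
      next
        case False
        then obtain j where j: "start b' + a = start b + j" by (metis le_Suc_ex not_less)
        then have "j \<le> b" using a 2 y(2) by simp
        then have eq: "b' = b" "a = j" using start_block_unique[OF j a(1)] by auto
        have "0 < a \<Longrightarrow> xs ! (start b + a) \<in> Q"
          using 2 a y(2) eq nth_mem[of "a - 1" zs] by (auto simp: nth_append nth_Cons')
        then show ?thesis using eq U(1) Q(2) 2(1) y(2) by (auto simp: nth_append)
      qed
    qed
  qed
  moreover have "clique M (set xs)" if "xs \<in> T'" for xs
  proof (cases "xs \<in> T")
    case True
    then show ?thesis using T by (simp add: built_def)
  next
    case False
    then have "set xs \<subseteq> insert c (set y \<union> Q)" using that by (auto simp: T'_def N_def)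
    then show ?thesis by (rule clique_mono[OF Q(4) order_refl])
  qed
  moreover have "y @ [c] \<in> N" by (auto simp: N_def)
  then have "T \<subset> T'" using NT by (auto simp: T'_def)
  ultimately show ?thesis by (auto simp: built_def)
qed

end

subsection \<open>From stages to an infinite play\<close>

text \<open>Koenig's lemma: always continue into a child with infinitely many descendants.\<close>

lemma infinite_tree_branch:
  assumes "infinite T" and "\<And>xs x. xs @ [x] \<in> T \<Longrightarrow> xs \<in> T" and "\<And>xs. xs \<in> T \<Longrightarrow> finite (children T xs)"
  shows "\<exists>x. \<forall>n. map x [0..<n] \<in> T"
proof -
  define big where "big xs \<longleftrightarrow> infinite {zs. xs @ zs \<in> T}" for xs
  have prefix: "xs \<in> T" if "xs @ zs \<in> T" for xs zs
    using that
  proof (induction zs rule: rev_induct)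
    case (snoc z zs)
    then show ?case using assms(2)[of "xs @ zs" z] by simp
  qed simp
  have big_in: "xs \<in> T" if "big xs" for xs
  proof -
    have "{zs. xs @ zs \<in> T} \<noteq> {}" using that unfolding big_def by (metis finite.emptyI)
    then show ?thesis using prefix by blast
  qed
  have ex: "\<exists>x. big (xs @ [x])" if "big xs" for xs
  proof (rule ccontr)
    assume none: "\<not> ?thesis"
    let ?Z = "insert [] (\<Union>x \<in> children T xs. (#) x ` {zs. (xs @ [x]) @ zs \<in> T})"
    have "{zs. xs @ zs \<in> T} \<subseteq> ?Z"
    proof
      fix zs assume "zs \<in> {zs. xs @ zs \<in> T}"
      then show "zs \<in> ?Z" using prefix[of "xs @ [hd zs]" "tl zs"] by (cases zs) (auto simp: children_def)
    qed
    moreover have "finite ?Z" using none assms(3)[OF big_in[OF that]] by (auto simp: big_def)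
    ultimately show False using that unfolding big_def by (meson finite_subset)
  qed
  define P where "P = rec_nat [] (\<lambda>n xs. xs @ [SOME x. big (xs @ [x])])"
  define x where "x n = (SOME x. big (P n @ [x]))" for n
  have P: "P 0 = []" "P (Suc n) = P n @ [x n]" for n by (simp_all add: P_def x_def)
  have "P n = map x [0..<n]" for n by (induction n) (auto simp: P)
  moreover have "big (P n)" for n
  proof (induction n)
    case 0
    show ?case using assms(1) by (simp add: P big_def)
  next
    case (Suc n)
    then show ?case using someI_ex[OF ex[OF Suc]] by (simp add: P x_def)
  qed
  ultimately show ?thesis using big_in by metis
qed

lemma infinite_edges: "infinite (edges K_aleph0)"
proof -
  have "inj (\<lambda>n::nat. {0, Suc n})" by (auto simp: inj_on_def doubleton_eq_iff)
  then have "infinite (range (\<lambda>n::nat. {0, Suc n}))" by (simp add: finite_image_iff)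
  moreover have "range (\<lambda>n::nat. {0, Suc n}) \<subseteq> edges K_aleph0" by auto
  ultimately show ?thesis by (meson finite_subset)
qed

lemma free_edge: "finite A \<Longrightarrow> \<exists>e. e \<in> edges K_aleph0 - A"
  using infinite_edges by (metis Diff_infinite_finite ex_in_conv finite.emptyI)

section \<open>Positions of a play, and a strategy with memory\<close>

definition maker_part :: "(nat \<Rightarrow> nat set) \<Rightarrow> nat \<Rightarrow> nat set set" where
  "maker_part p t = (\<lambda>i. p (2 * i)) ` {..<t}"

definition breaker_part :: "(nat \<Rightarrow> nat set) \<Rightarrow> nat \<Rightarrow> nat set set" where
  "breaker_part p t = (\<lambda>i. p (Suc (2 * i))) ` {..<t}"

lemma parts_Suc:
  "maker_part p (Suc t) = insert (p (2 * t)) (maker_part p t)"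
  "breaker_part p (Suc t) = insert (p (Suc (2 * t))) (breaker_part p t)"
  by (auto simp: maker_part_def breaker_part_def lessThan_Suc)

lemma parts_history: "set (map p [0..<2 * t]) = maker_part p t \<union> breaker_part p t"
  by (induction t) (auto simp: parts_Suc, auto simp: maker_part_def breaker_part_def)

lemma position_parts:
  assumes "legal_play K_aleph0 p" shows "position (maker_part p t) (breaker_part p t)"
  using assms by (auto simp: position_def maker_part_def breaker_part_def legal_play_def)

text \<open>
  Maker remembers the current stage and a bound on the number of moves until the next one.
\<close>

lemma strategy_of_stages:
  fixes st :: "'s \<Rightarrow> nat set set \<Rightarrow> bool" and step :: "'s \<Rightarrow> 's \<Rightarrow> bool"
  assumes init: "st s0 {}" and mono: "\<And>s M M'. st s M \<Longrightarrow> M \<subseteq> M' \<Longrightarrow> st s M'"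
    and forced: "\<And>s M0. st s M0 \<Longrightarrow> \<exists>N. \<forall>M B. position M B \<longrightarrow> st s M \<longrightarrow>
      force N (\<lambda>M' B'. \<exists>s'. step s s' \<and> st s' M') M B"
  shows "\<exists>\<sigma>. maker_strategy K_aleph0 \<sigma> \<and> (\<forall>p. legal_play K_aleph0 p \<and> follows \<sigma> p \<longrightarrow>
    (\<exists>s. (\<forall>t. st (s t) (maker_part p t)) \<and> (\<forall>t. s (Suc t) = s t \<or> step (s t) (s (Suc t))) \<and>
      (\<forall>t. \<exists>t'\<ge>t. step (s t') (s (Suc t')))))"
proof -
  define Q where "Q s = (\<lambda>M' (B' :: nat set set). \<exists>s'. step s s' \<and> st s' M')" for s
  obtain N where N: "\<And>s M B. position M B \<Longrightarrow> st s M \<Longrightarrow> force (N s) (Q s) M B"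
    using forced unfolding Q_def by metis
  define good where "good m M B \<longleftrightarrow> st (fst m) M \<and> force (snd m) (Q (fst m)) M B" for m :: "'s \<times> nat" and M B
  \<comment> \<open>A move comes with the next memory, a stage and a counter. Each round advances
    the stage or lowers the counter, which rules out that a stage lasts forever.\<close>
  define ok where "ok m M B em \<longleftrightarrow> fst em \<in> edges K_aleph0 - M - B \<and>
    (\<forall>e' \<in> edges K_aleph0 - M - B - {fst em}. good (snd em) (insert (fst em) M) (insert e' B)) \<and>
    (step (fst m) (fst (snd em)) \<or> fst (snd em) = fst m \<and> snd (snd em) < snd m)" for m M B em
  have ex: "\<exists>em. ok m M B em" if pos: "position M B" and g: "good m M B" for m M B
  proof (cases "Q (fst m) M B")
    case True
    then obtain s' where s': "step (fst m) s'" "st s' M" by (auto simp: Q_def)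
    \<comment> \<open>The goal of the stage is already reached, so any free edge will do and the
      counter restarts at \<open>N s'\<close>.\<close>
    obtain e where e: "e \<in> edges K_aleph0 - (M \<union> B)" using free_edge[of "M \<union> B"] pos by (auto simp: position_def)
    have "good (s', N s') (insert e M) (insert e' B)" if "e' \<in> edges K_aleph0 - M - B - {e}" for e'
    proof -
      have "position (insert e M) (insert e' B)" using pos e that by (auto simp: position_def)
      moreover have "st s' (insert e M)" using s'(2) by (rule mono) auto
      ultimately show ?thesis using N by (simp add: good_def)
    qed
    then show ?thesis using s' e by (intro exI[of _ "(e, s', N s')"]) (auto simp: ok_def)
  next
    case False
    have "snd m \<noteq> 0"
    proof
      assume "snd m = 0"
      then have "force 0 (Q (fst m)) M B" using g unfolding good_def by metis
      then show False using False unfolding force.simps(1) by blast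
    qed
    then obtain r where r: "snd m = Suc r" using not0_implies_Suc by blast
    have "force (Suc r) (Q (fst m)) M B" using g r by (simp add: good_def)
    then obtain e where e: "e \<in> edges K_aleph0 - M - B"
      "\<And>e'. e' \<in> edges K_aleph0 - M - B - {e} \<Longrightarrow> force r (Q (fst m)) (insert e M) (insert e' B)"
      using False by (auto simp: force.simps(2))
    moreover have "st (fst m) (insert e M)" using g mono[of "fst m" M "insert e M"] by (auto simp: good_def)
    ultimately show ?thesis using r by (intro exI[of _ "(e, fst m, r)"]) (auto simp: ok_def good_def)
  qed
  define mv where "mv m M B = (SOME em. ok m M B em)" for m M B
  have mv: "ok m M B (mv m M B)" if "position M B" "good m M B" for m M B
    unfolding mv_def using ex[OF that] by (rule someI_ex)
  \<comment> \<open>The memory at time \<open>t\<close> depends only on moves before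
    \<open>2 * t\<close>, so a history can replace the whole play.\<close>
  define mem where "mem p = rec_nat (s0, N s0) (\<lambda>t m. snd (mv m (maker_part p t) (breaker_part p t)))" for p
  have mem_0: "mem p 0 = (s0, N s0)"
    and mem_Suc: "mem p (Suc t) = snd (mv (mem p t) (maker_part p t) (breaker_part p t))" for p t
    by (simp_all add: mem_def)
  define move where "move p t = fst (mv (mem p t) (maker_part p t) (breaker_part p t))" for p t
  \<comment> \<open>The default edge keeps \<open>\<sigma>\<close> legal at positions that do not
    arise when it is followed.\<close>
  define \<sigma> where "\<sigma> h = (let e = move ((!) h) (length h div 2) in
    if e \<in> edges K_aleph0 - set h then e else SOME e. e \<in> edges K_aleph0 - set h)" for h
  have "maker_strategy K_aleph0 \<sigma>"
    unfolding maker_strategy_def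
  proof (intro allI impI)
    fix h :: "nat set list"
    have "(SOME e. e \<in> edges K_aleph0 - set h) \<in> edges K_aleph0 - set h"
      by (rule someI_ex[OF free_edge]) simp
    then show "\<sigma> h \<in> edges K_aleph0 - set h" unfolding \<sigma>_def Let_def by presburger
  qed
  moreover have "\<exists>s. (\<forall>t. st (s t) (maker_part p t)) \<and> (\<forall>t. s (Suc t) = s t \<or> step (s t) (s (Suc t))) \<and>
      (\<forall>t. \<exists>t'\<ge>t. step (s t') (s (Suc t')))" if p: "legal_play K_aleph0 p" "follows \<sigma> p" for p
  proof -
    have hist: "maker_part ((!) (map p [0..<2 * t])) u = maker_part p u \<and>
        breaker_part ((!) (map p [0..<2 * t])) u = breaker_part p u" if "u \<le> t" for t u
      using that by (auto simp: maker_part_def breaker_part_def)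
    have hist_mem: "mem ((!) (map p [0..<2 * t])) u = mem p u" if "u \<le> t" for t u
      using that hist by (induction u) (auto simp: mem_0 mem_Suc)
    have hist_move: "move ((!) (map p [0..<2 * t])) t = move p t" for t
      using hist[of t t] hist_mem[of t t] by (simp add: move_def)
    have pos: "position (maker_part p t) (breaker_part p t)" for t
      using p(1) by (rule position_parts)
    have inv: "good (mem p t) (maker_part p t) (breaker_part p t)" for t
    proof (induction t)
      case 0
      show ?case using init N[of "{}" "{}" s0]
        by (simp add: mem_0 good_def maker_part_def breaker_part_def position_def)
    next
      case (Suc t)
      have ok: "ok (mem p t) (maker_part p t) (breaker_part p t) (mv (mem p t) (maker_part p t) (breaker_part p t))"
        using mv[OF pos Suc] .
      then have "move p t \<in> edges K_aleph0 - set (map p [0..<2 * t])"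
        unfolding parts_history move_def ok_def by blast
      then have pt: "p (2 * t) = move p t"
        using p(2) hist_move[of t] by (simp add: follows_def \<sigma>_def)
      have "p (Suc (2 * t)) \<notin> p ` {..2 * t}" "p (Suc (2 * t)) \<in> edges K_aleph0"
        using p(1) by (auto simp: legal_play_def dest: injD)
      moreover have "maker_part p t \<union> breaker_part p t \<union> {p (2 * t)} \<subseteq> p ` {..2 * t}"
        by (auto simp: maker_part_def breaker_part_def)
      ultimately have "p (Suc (2 * t)) \<in> edges K_aleph0 - maker_part p t - breaker_part p t - {move p t}"
        using pt by auto
      then show ?case using ok pt by (simp add: ok_def parts_Suc mem_Suc move_def)
    qed
    define s where "s t = fst (mem p t)" for t
    have prog: "step (s t) (s (Suc t)) \<or> s (Suc t) = s t \<and> snd (mem p (Suc t)) < snd (mem p t)" for t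
      using mv[OF pos inv, of t] by (simp add: ok_def s_def mem_Suc)
    have "\<exists>t'\<ge>t. step (s t') (s (Suc t'))" for t
    proof (rule ccontr)
      assume "\<not> ?thesis"
      then have dec: "snd (mem p (Suc t')) < snd (mem p t')" if "t' \<ge> t" for t' using prog that by blast
      have "snd (mem p (t + i)) + i \<le> snd (mem p t)" for i
      proof (induction i)
        case (Suc i)
        then show ?case using dec[of "t + i"] by simp
      qed simp
      from this[of "Suc (snd (mem p t))"] show False by simp
    qed
    then show ?thesis using inv prog by (intro exI[of _ s]) (auto simp: s_def good_def)
  qed
  ultimately show ?thesis by blast
qed

section \<open>The infinite branch through all stages\<close>

context star_supply
begin

lemma built_root: "built {[]} {}"
proof -
  have "children {[]} [] = {}" by (auto simp: children_def)
  then show ?thesis by (auto simp: built_def tree_def clique_def intro: image_eqI[of _ _ 0])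
qed

text \<open>The stages grow infinitely often, so their union is infinite, and \<open>cap\<close>
  bounds its branching independently of the stage. Each initial part of a branch lies in some stage
  and is therefore a clique of Maker.\<close>

lemma branch_strategy:
  "\<exists>\<sigma>. maker_strategy K_aleph0 \<sigma> \<and> (\<forall>p. legal_play K_aleph0 p \<and> follows \<sigma> p \<longrightarrow>
    (\<exists>x. inj x \<and> (\<forall>i j. i \<noteq> j \<longrightarrow> {x i, x j} \<in> maker_edges p) \<and>
      (\<forall>b a. a \<le> b \<longrightarrow> (\<exists>L. (x (start b), L) \<in> U (b mod k) \<and> (0 < a \<longrightarrow> x (start b + a) \<in> L)))))"
proof -
  have "\<exists>N. \<forall>M B. position M B \<longrightarrow> built T M \<longrightarrow> force N (\<lambda>M' B'. \<exists>T'. T \<subset> T' \<and> built T' M') M B"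
    if "built T M0" for T M0
  proof -
    obtain N where N: "\<And>M B. position M B \<Longrightarrow> built T M \<Longrightarrow> force N (\<lambda>M' B'. extendable T M') M B"
      using force_extendable[of T] \<open>built T M0\<close> by (auto simp: built_def)
    have "force N (\<lambda>M' B'. \<exists>T'. T \<subset> T' \<and> built T' M') M B" if "position M B" "built T M" for M B
    proof (rule force_conseq[OF N[OF that] that(1)])
      fix M' B' assume "reach N M B M' B'" "extendable T M'"
      then show "\<exists>T'. T \<subset> T' \<and> built T' M'"
        using extendable_step built_mono[OF that(2)] by (auto simp: reach_def)
    qed
    then show ?thesis by blast
  qed
  note forced = this
  have "\<exists>\<sigma>. maker_strategy K_aleph0 \<sigma> \<and> (\<forall>p. legal_play K_aleph0 p \<and> follows \<sigma> p \<longrightarrow>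
    (\<exists>s. (\<forall>t. built (s t) (maker_part p t)) \<and> (\<forall>t. s (Suc t) = s t \<or> s t \<subset> s (Suc t)) \<and>
      (\<forall>t. \<exists>t'\<ge>t. s t' \<subset> s (Suc t'))))"
    by (rule strategy_of_stages[of built, OF built_root]) (erule built_mono, assumption, erule forced)
  then obtain \<sigma> where \<sigma>: "maker_strategy K_aleph0 \<sigma> \<and> (\<forall>p. legal_play K_aleph0 p \<and> follows \<sigma> p \<longrightarrow>
    (\<exists>s. (\<forall>t. built (s t) (maker_part p t)) \<and> (\<forall>t. s (Suc t) = s t \<or> s t \<subset> s (Suc t)) \<and>
      (\<forall>t. \<exists>t'\<ge>t. s t' \<subset> s (Suc t'))))" by (rule exE)
  have "\<exists>x. inj x \<and> (\<forall>i j. i \<noteq> j \<longrightarrow> {x i, x j} \<in> maker_edges p) \<and>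
      (\<forall>b a. a \<le> b \<longrightarrow> (\<exists>L. (x (start b), L) \<in> U (b mod k) \<and> (0 < a \<longrightarrow> x (start b + a) \<in> L)))"
    if p: "legal_play K_aleph0 p" "follows \<sigma> p" for p
  proof -
    obtain s where s: "\<And>t. built (s t) (maker_part p t)" "\<And>t. s (Suc t) = s t \<or> s t \<subset> s (Suc t)"
        "\<And>t. \<exists>t'\<ge>t. s t' \<subset> s (Suc t')"
      using \<sigma>[THEN conjunct2, rule_format, OF conjI[OF p]] by (elim exE conjE) metis
    have tr: "tree (s t)" for t using s(1)[of t] by (simp add: built_def)
    have mono: "s t \<subseteq> s u" if "t \<le> u" for t u
      by (rule lift_Suc_mono_le[of s, OF _ that]) (use s(2) in blast)
    define T where "T = (\<Union>t. s t)"
    have "infinite T"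
    proof
      assume "finite T"
      have "\<exists>t. n \<le> card (s t)" for n
      proof (induction n)
        case (Suc n)
        then obtain t where t: "n \<le> card (s t)" by blast
        obtain u where u: "t \<le> u" "s u \<subset> s (Suc u)" using s(3) by blast
        have "card (s t) \<le> card (s u)" using mono[OF u(1)] tr by (auto intro!: card_mono simp: tree_def)
        also have "\<dots> < card (s (Suc u))" using u(2) tr by (auto intro!: psubset_card_mono simp: tree_def)
        finally show ?case using t by (intro exI[of _ "Suc u"]) simp
      qed simp
      then obtain t where "Suc (card T) \<le> card (s t)" by blast
      moreover have "card (s t) \<le> card T" using \<open>finite T\<close> by (intro card_mono) (auto simp: T_def)
      ultimately show False by simp
    qed
    moreover have "xs \<in> T" if "xs @ [x] \<in> T" for xs x
      using that tr unfolding T_def tree_def by blast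
    moreover have "finite (children T xs)" for xs
    proof (rule ccontr)
      assume "infinite (children T xs)"
      then obtain A where A: "A \<subseteq> children T xs" "finite A" "card A = Suc (cap (length xs))"
        using infinite_arbitrarily_large by metis
      have "\<exists>t. A \<subseteq> children (s t) xs"
        using A(2,1)
      proof (induction A rule: finite_induct)
        case (insert a A)
        then obtain t where t: "A \<subseteq> children (s t) xs" by auto
        obtain u where "xs @ [a] \<in> s u" using insert by (auto simp: T_def children_def)
        then have "insert a A \<subseteq> children (s (max t u)) xs"
          using t mono[of t "max t u"] mono[of u "max t u"] by (auto simp: children_def)
        then show ?case by blast
      qed simp
      then obtain t where t: "A \<subseteq> children (s t) xs" by blast
      have "A \<noteq> {}" using A(3) by auto
      then have "xs \<in> s t" using t tr[of t] by (auto simp: children_def tree_def)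
      then have "card (children (s t) xs) \<le> cap (length xs)" using tr[of t] by (auto simp: tree_def)
      moreover have "card A \<le> card (children (s t) xs)" using t tr[of t] by (intro card_mono) (auto simp: tree_def)
      ultimately show False using A(3) by simp
    qed
    ultimately obtain x where x: "\<And>n. map x [0..<n] \<in> T" using infinite_tree_branch by metis
    have part: "maker_part p t \<subseteq> maker_edges p" for t by (auto simp: maker_part_def maker_edges_def)
    have good: "\<exists>M. built (s t) M \<and> M \<subseteq> maker_edges p" for t using s(1) part by blast
    have at: "\<exists>t M. map x [0..<n] \<in> s t \<and> built (s t) M \<and> M \<subseteq> maker_edges p" for n
      using x[of n] good by (auto simp: T_def)
    have dist: "x i \<noteq> x j" if "i < j" for i j
    proof -
      have "distinct (map x [0..<Suc j])" using at[of "Suc j"] by (auto simp: built_def tree_def)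
      then show ?thesis using that nth_eq_iff_index_eq[of "map x [0..<Suc j]" i j] by (simp del: upt_Suc)
    qed
    have "inj x" using dist by (metis injI linorder_neqE_nat)
    moreover have "{x i, x j} \<in> maker_edges p" if "i \<noteq> j" for i j
    proof -
      obtain M where "clique M (x ` {..<Suc (max i j)})" "M \<subseteq> maker_edges p"
        using at[of "Suc (max i j)"] by (auto simp: built_def lessThan_atLeast0 simp del: upt_Suc)
      moreover have "x i \<noteq> x j" using dist that by (metis linorder_neqE_nat)
      moreover have "i < Suc (max i j)" "j < Suc (max i j)" by auto
      ultimately show ?thesis unfolding clique_def by blast
    qed
    moreover have "\<exists>L. (x (start b), L) \<in> U (b mod k) \<and> (0 < a \<longrightarrow> x (start b + a) \<in> L)" if "a \<le> b" for a b
    proof -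
      obtain t where t: "map x [0..<Suc (start b + a)] \<in> s t" using at by blast
      then have "\<exists>c L. (c, L) \<in> U (b mod k) \<and> map x [0..<Suc (start b + a)] ! start b = c \<and>
        (0 < a \<longrightarrow> map x [0..<Suc (start b + a)] ! (start b + a) \<in> L)"
      proof -
        have "start b + a < length (map x [0..<Suc (start b + a)])" by simp
        then show ?thesis using t tr[of t] that unfolding tree_def by blast
      qed
      then show ?thesis by (simp del: upt_Suc)
    qed
    ultimately show ?thesis by blast
  qed
  then show ?thesis using \<sigma> by metis
qed

end

subsection \<open>Embedding the pattern\<close>

lemma edges_G_cli:
  "a < j \<Longrightarrow> a' < j' \<Longrightarrow> {(j, a), (j', a')} \<in> edges G_cli \<longleftrightarrow> j = j' \<and> a \<noteq> a'"
  by (auto simp: G_cli_def doubleton_eq_iff)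

lemma edges_G_star:
  "a < j \<Longrightarrow> a' < j' \<Longrightarrow> {(j, a), (j', a')} \<in> edges G_star \<longleftrightarrow> j = j' \<and> a \<noteq> a' \<and> (a = 0 \<or> a' = 0)"
  by (auto simp: G_star_def doubleton_eq_iff)

lemma simple_graph_edgeD:
  "simple_graph G \<Longrightarrow> {x, y} \<in> edges G \<Longrightarrow> x \<in> verts G \<and> y \<in> verts G"
  by (fastforce simp: simple_graph_def doubleton_eq_iff)

text \<open>\<open>C\<close> tells cliques from stars, so that both cases share one edge
  condition.\<close>

definition coordinates :: "'v graph \<Rightarrow> ('v \<Rightarrow> nat \<times> nat) \<Rightarrow> bool \<Rightarrow> bool" where
  "coordinates H \<phi> C \<longleftrightarrow> bij_betw \<phi> (verts H) {(j, a). a < j} \<and>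
    (\<forall>x y. {x, y} \<in> edges H \<longleftrightarrow> x \<in> verts H \<and> y \<in> verts H \<and> fst (\<phi> x) = fst (\<phi> y) \<and>
      snd (\<phi> x) \<noteq> snd (\<phi> y) \<and> (C \<or> snd (\<phi> x) = 0 \<or> snd (\<phi> y) = 0))"

lemma star_clique_coordinates:
  assumes "copy_of H G_star \<or> copy_of H G_cli"
  shows "\<exists>\<phi> C. coordinates H \<phi> C"
proof -
  obtain C :: bool and W :: "(nat \<times> nat) graph" where W: "copy_of H W" "verts W = {(j, a). a < j}"
    and E: "\<And>j a j' a'. a < j \<Longrightarrow> a' < j' \<Longrightarrow>
      {(j, a), (j', a')} \<in> edges W \<longleftrightarrow> j = j' \<and> a \<noteq> a' \<and> (C \<or> a = 0 \<or> a' = 0)"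
  proof (cases "copy_of H G_cli")
    case True
    show ?thesis
      by (rule that[of G_cli True]) (simp_all add: True edges_G_cli, simp add: G_cli_def)
  next
    case False
    show ?thesis
      by (rule that[of G_star False]) (use False assms in \<open>simp_all add: edges_G_star\<close>, simp add: G_star_def)
  qed
  obtain \<phi> where \<phi>: "bij_betw \<phi> (verts H) (verts W)"
    "\<forall>x \<in> verts H. \<forall>y \<in> verts H. {x, y} \<in> edges H \<longleftrightarrow> {\<phi> x, \<phi> y} \<in> edges W" and "simple_graph H"
    using W(1) by (auto simp: copy_of_def)
  have "snd (\<phi> x) < fst (\<phi> x)" if "x \<in> verts H" for x
    using bij_betwE[OF \<phi>(1)] that W(2) by fastforce
  then have W_edge: "{\<phi> x, \<phi> y} \<in> edges W \<longleftrightarrow> fst (\<phi> x) = fst (\<phi> y) \<and>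
      snd (\<phi> x) \<noteq> snd (\<phi> y) \<and> (C \<or> snd (\<phi> x) = 0 \<or> snd (\<phi> y) = 0)" if "x \<in> verts H" "y \<in> verts H" for x y
    using E[of "snd (\<phi> x)" "fst (\<phi> x)" "snd (\<phi> y)" "fst (\<phi> y)"] that by simp
  have "{x, y} \<in> edges H \<longleftrightarrow> x \<in> verts H \<and> y \<in> verts H \<and> fst (\<phi> x) = fst (\<phi> y) \<and>
      snd (\<phi> x) \<noteq> snd (\<phi> y) \<and> (C \<or> snd (\<phi> x) = 0 \<or> snd (\<phi> y) = 0)" for x y
  proof (cases "x \<in> verts H \<and> y \<in> verts H")
    case True
    then show ?thesis using W_edge[of x y] \<phi>(2) by simp
  next
    case False
    then show ?thesis using simple_graph_edgeD[OF \<open>simple_graph H\<close>] by blast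
  qed
  then have "coordinates H \<phi> C" using \<phi>(1) W(2) by (simp add: coordinates_def)
  then show ?thesis by blast
qed

text \<open>The pattern concerns edges only. Surplus positions of a block are therefore skipped, and
  a vertex outside all \<open>G i\<close> may land on a centre, provided that no other vertex of
  that component is in the image.\<close>

theorem corollary1p2:
  fixes k :: nat and G :: "nat \<Rightarrow> nat graph"
  assumes "k \<ge> 1"
    and "\<And>i. i \<in> {1..k} \<Longrightarrow> subgraph (G i) K_aleph0"
    and "\<And>i j. i \<in> {1..k} \<Longrightarrow> j \<in> {1..k} \<Longrightarrow> i \<noteq> j \<Longrightarrow> verts (G i) \<inter> verts (G j) = {}"
    and "\<And>i. i \<in> {1..k} \<Longrightarrow> copy_of (G i) G_star \<or> copy_of (G i) G_cli"
  shows "maker_has_winning_strategy K_aleph0 (MB_pat K_aleph0 k G)"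
proof -
  have "\<forall>i \<in> {1..k}. \<exists>\<phi>C. coordinates (G i) (fst \<phi>C) (snd \<phi>C)"
  proof
    fix i assume "i \<in> {1..k}"
    then obtain \<phi> C where "coordinates (G i) \<phi> C" using star_clique_coordinates assms(4) by blast
    then have "coordinates (G i) (fst (\<phi>, C)) (snd (\<phi>, C))" by simp
    then show "\<exists>\<phi>C. coordinates (G i) (fst \<phi>C) (snd \<phi>C)" by (rule exI)
  qed
  then obtain \<phi>C where "\<forall>i \<in> {1..k}. coordinates (G i) (fst (\<phi>C i)) (snd (\<phi>C i))"
    by (rule bchoice[THEN exE])
  moreover define \<phi> C where "\<phi> i = fst (\<phi>C i)" and "C i = snd (\<phi>C i)" for i
  ultimately have coord: "\<And>i. i \<in> {1..k} \<Longrightarrow> coordinates (G i) (\<phi> i) (C i)" by simp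
  have bij: "bij_betw (\<phi> i) (verts (G i)) {(j, a). a < j}"
    and edge: "{x, y} \<in> edges (G i) \<longleftrightarrow>
      x \<in> verts (G i) \<and> y \<in> verts (G i) \<and> fst (\<phi> i x) = fst (\<phi> i y) \<and>
      snd (\<phi> i x) \<noteq> snd (\<phi> i y) \<and> (C i \<or> snd (\<phi> i x) = 0 \<or> snd (\<phi> i y) = 0)"
    if "i \<in> {1..k}" for i x y
  proof -
    note c = coord[OF that, unfolded coordinates_def]
    show "bij_betw (\<phi> i) (verts (G i)) {(j, a). a < j}" by (rule conjunct1[OF c])
    show "{x, y} \<in> edges (G i) \<longleftrightarrow>
      x \<in> verts (G i) \<and> y \<in> verts (G i) \<and> fst (\<phi> i x) = fst (\<phi> i y) \<and>
      snd (\<phi> i x) \<noteq> snd (\<phi> i y) \<and> (C i \<or> snd (\<phi> i x) = 0 \<or> snd (\<phi> i y) = 0)"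
      by (rule conjunct2[OF c, rule_format])
  qed
  have \<phi>_less: "snd (\<phi> i x) < fst (\<phi> i x)" if "i \<in> {1..k}" "x \<in> verts (G i)" for i x
    using bij_betwE[OF bij[OF that(1)]] that(2) by fastforce
  have \<phi>_inj: "x = y" if "i \<in> {1..k}" "x \<in> verts (G i)" "y \<in> verts (G i)" "\<phi> i x = \<phi> i y" for i x y
    using bij_betw_imp_inj_on[OF bij[OF that(1)]] that by (auto dest: inj_onD)
  \<comment> \<open>Colours start at 0 and graphs at 1. In a clique the vertex with second
    coordinate 0 acts as centre.\<close>
  define U where "U i = {(c, {x \<in> verts (G (Suc i)). fst (\<phi> (Suc i) x) = fst (\<phi> (Suc i) c) \<and> snd (\<phi> (Suc i) x) \<noteq> 0}) |c.
    c \<in> verts (G (Suc i)) \<and> snd (\<phi> (Suc i) c) = 0}" for i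
  interpret star_supply k U
  proof
    show "0 < k" using assms(1) by simp
    fix i m :: nat and X :: "nat set" assume i: "i < k" and X: "finite X"
    let ?\<phi> = "\<phi> (Suc i)" and ?V = "verts (G (Suc i))"
    have b: "bij_betw ?\<phi> ?V {(j, a). a < j}" using i by (intro bij) auto
    \<comment> \<open>Component \<open>j\<close> lies beyond all components that meet
      \<open>X\<close> and has \<open>j - 1 \<ge> m\<close> leaves.\<close>
    define j where "j = m + 2 + (\<Sum>x\<in>X. fst (?\<phi> x))"
    have jX: "fst (?\<phi> x) < j" if "x \<in> X" for x
      using member_le_sum[OF that, of "\<lambda>x. fst (?\<phi> x)"] X by (simp add: j_def)
    have "(j, 0) \<in> ?\<phi> ` ?V" using b by (auto simp: bij_betw_def j_def)
    then obtain c where c: "c \<in> ?V" "?\<phi> c = (j, 0)" by (metis imageE)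
    define L where "L = {x \<in> ?V. fst (?\<phi> x) = j \<and> snd (?\<phi> x) \<noteq> 0}"
    have "?\<phi> ` L = {j} \<times> {1..<j}"
    proof
      show "?\<phi> ` L \<subseteq> {j} \<times> {1..<j}" 
      proof
        fix z assume "z \<in> ?\<phi> ` L"
        then obtain y where y: "z = ?\<phi> y" "y \<in> ?V" "fst (?\<phi> y) = j" "snd (?\<phi> y) \<noteq> 0" by (auto simp: L_def)
        moreover have "snd (?\<phi> y) < fst (?\<phi> y)" using i y by (intro \<phi>_less) auto
        ultimately show "z \<in> {j} \<times> {1..<j}" by (auto simp: mem_Times_iff)
      qed
      show "{j} \<times> {1..<j} \<subseteq> ?\<phi> ` L"
      proof
        fix z assume z: "z \<in> {j} \<times> {1..<j}"
        then have "z \<in> ?\<phi> ` ?V" using b by (auto simp: bij_betw_def)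
        then obtain y where "z = ?\<phi> y" "y \<in> ?V" by blast
        then show "z \<in> ?\<phi> ` L" using z by (auto simp: L_def mem_Times_iff)
      qed
    qed
    moreover have inj: "inj_on ?\<phi> L" using b by (auto simp: bij_betw_def L_def intro: inj_on_subset)
    ultimately have "finite L" "card L = j - 1"
      using finite_imageD[OF _ inj] card_image[OF inj] by (simp_all add: card_cartesian_product)
    moreover have "(c, L) \<in> U i" using c by (auto simp: U_def L_def)
    moreover have "x \<notin> X" if "fst (?\<phi> x) = j" for x using jX[of x] that by auto
    then have "c \<notin> L" "insert c L \<inter> X = {}" using c by (auto simp: L_def)
    moreover have "m \<le> j - 1" by (simp add: j_def)
    ultimately show "\<exists>c L. (c, L) \<in> U i \<and> finite L \<and> c \<notin> L \<and> m \<le> card L \<and> insert c L \<inter> X = {}" by metis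
  qed
  have "MB_pat K_aleph0 k G p"
    if x: "inj x" "\<And>i j. i \<noteq> j \<Longrightarrow> {x i, x j} \<in> maker_edges p"
      "\<And>b a. a \<le> b \<Longrightarrow> \<exists>L. (x (start b), L) \<in> U (b mod k) \<and> (0 < a \<longrightarrow> x (start b + a) \<in> L)"
    for x :: "nat \<Rightarrow> nat" and p
  proof -
    define col where "col b = Suc (b mod k)" for b
    have col: "col b \<in> {1..k}" for b using assms(1) by (simp add: col_def Suc_le_eq)
    define J where "J b = fst (\<phi> (col b) (x (start b)))" for b
    have centre: "x (start b) \<in> verts (G (col b)) \<and> snd (\<phi> (col b) (x (start b))) = 0" for b
      using x(3)[of 0 b] by (auto simp: U_def col_def)
    \<comment> \<open>Which leaf stands at position \<open>a\<close> is irrelevant: leaves of a star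
      are interchangeable, and so are the vertices of a clique.\<close>
    have pos: "x (start b + a) \<in> verts (G (col b)) \<and> fst (\<phi> (col b) (x (start b + a))) = J b \<and>
        (snd (\<phi> (col b) (x (start b + a))) = 0 \<longleftrightarrow> a = 0)" if "a \<le> b" for a b
      using x(3)[OF that] centre[of b] by (cases "a = 0") (auto simp: U_def col_def J_def)
    \<comment> \<open>No component is visited twice: colour and component determine the centre, and
      \<open>x\<close> is injective.\<close>
    have J_inj: "b = b'" if "col b = col b'" "J b = J b'" for b b'
    proof -
      have "x (start b) = x (start b')"
        using \<phi>_inj[OF col[of b], of "x (start b)" "x (start b')"] centre[of b] centre[of b'] that
        by (simp add: J_def prod_eq_iff)
      then show ?thesis using x(1) by (auto dest: injD)
    qed
    have disj: "i = i'" if "i \<in> {1..k}" "i' \<in> {1..k}" "u \<in> verts (G i)" "u \<in> verts (G i')" for i i' u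
      using assms(3)[OF that(1,2)] that(3,4) by blast
    \<comment> \<open>Block numbers: the component of size \<open>j\<close> in \<open>G i\<close> goes to the even multiple \<open>2 j k\<close> plus \<open>i - 1\<close>, while
      a vertex outside all \<open>G i\<close> gets its own block at an odd multiple of \<open>k\<close>, of which only the centre is used.\<close>
    define owned where "owned u i \<longleftrightarrow> i \<in> {1..k} \<and> u \<in> verts (G i)" for u i
    have owned_unique: "owned u i \<Longrightarrow> owned u i' \<Longrightarrow> i = i'" for u i i'
      unfolding owned_def using disj by blast
    have "\<exists>b a. a \<le> b \<and> (\<forall>i. owned u i \<longrightarrow> b = k * (2 * fst (\<phi> i u)) + (i - 1) \<and> a = snd (\<phi> i u)) \<and>
      ((\<nexists>i. owned u i) \<longrightarrow> b = k * (2 * u + 1) \<and> a = 0)" for u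
    proof (cases "\<exists>i. owned u i")
      case True
      then obtain i where i: "owned u i" by blast
      have "snd (\<phi> i u) \<le> k * (2 * fst (\<phi> i u)) + (i - 1)"
      proof -
        have "snd (\<phi> i u) \<le> 1 * (2 * fst (\<phi> i u))" using \<phi>_less[of i u] i by (simp add: owned_def)
        also have "\<dots> \<le> k * (2 * fst (\<phi> i u))" using assms(1) by (rule mult_le_mono1)
        finally show ?thesis by simp
      qed
      then show ?thesis using i owned_unique by metis
    next
      case False
      then show ?thesis by blast
    qed
    then obtain blk idx where idx: "\<And>u. idx u \<le> blk u"
      and own: "\<And>u i. owned u i \<Longrightarrow> blk u = k * (2 * fst (\<phi> i u)) + (i - 1) \<and> idx u = snd (\<phi> i u)"
      and single: "\<And>u. \<nexists>i. owned u i \<Longrightarrow> blk u = k * (2 * u + 1) \<and> idx u = 0"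
      by metis
    have k: "0 < k" using assms(1) by simp
    have own_div: "blk u div k = 2 * fst (\<phi> i u) \<and> col (blk u) = i" if o: "owned u i" for u i
    proof -
      obtain r where r: "i = Suc r" "r < k" using o by (cases i) (auto simp: owned_def)
      then show ?thesis using own[OF o] k by (simp add: col_def)
    qed
    have single_div: "blk u div k = 2 * u + 1" if "\<nexists>i. owned u i" for u
      using single[OF that] k by simp
    \<comment> \<open>The parity of \<open>blk u div k\<close> separates vertices outside all
      \<open>G i\<close> from the others; for the latter, the quotient gives the component and the
      remainder the graph.\<close>
    have owned_eq: "\<exists>i. owned u i \<and> owned v i \<and> fst (\<phi> i u) = fst (\<phi> i v)"
      if uv: "blk u = blk v" "u \<noteq> v" for u v
    proof -
      have "\<exists>i. owned u i"
      proof (rule ccontr)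
        assume u: "\<not> ?thesis"
        show False
        proof (cases "\<exists>i. owned v i")
          case True
          then obtain i where "owned v i" by blast
          then have "2 * fst (\<phi> i v) = 2 * u + 1" using own_div single_div[OF u] uv by metis
          then show False by presburger
        next
          case False
          then have "2 * v + 1 = 2 * u + 1" using single_div[OF u] single_div[OF False] uv by metis
          then show False using uv by simp
        qed
      qed
      then obtain i where i: "owned u i" by blast
      have "\<exists>i. owned v i"
      proof (rule ccontr)
        assume v: "\<not> ?thesis"
        have "2 * fst (\<phi> i u) = 2 * v + 1" using own_div[OF i] single_div[OF v] uv by metis
        then show False by presburger
      qed
      then obtain i' where i': "owned v i'" by blast
      show ?thesis using own_div[OF i] own_div[OF i'] i i' uv by auto
    qed
    define f where "f u = x (start (blk u) + idx u)" for u
    have f_inj: "u = v" if "f u = f v" for u v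
    proof (rule ccontr)
      assume "u \<noteq> v"
      have "start (blk u) + idx u = start (blk v) + idx v" using that x(1) by (auto simp: f_def dest: injD)
      then have eq: "blk u = blk v" "idx u = idx v" using start_block_unique idx by blast+
      then obtain i where i: "owned u i" "owned v i" "fst (\<phi> i u) = fst (\<phi> i v)"
        using owned_eq \<open>u \<noteq> v\<close> by blast
      then have "\<phi> i u = \<phi> i v" using own[OF i(1)] own[OF i(2)] eq by (simp add: prod_eq_iff)
      then show False using \<phi>_inj i \<open>u \<noteq> v\<close> by (auto simp: owned_def)
    qed
    have f_pos: "f u \<in> verts (G (col (blk u))) \<and> fst (\<phi> (col (blk u)) (f u)) = J (blk u) \<and>
        (snd (\<phi> (col (blk u)) (f u)) = 0 \<longleftrightarrow> idx u = 0)" for u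
      unfolding f_def by (rule pos[OF idx])
    have pattern: "{u, v} \<in> edges (G i) \<longleftrightarrow> {f u, f v} \<in> edges (G i)" if i: "i \<in> {1..k}" for u v i
    proof
      assume uv: "{u, v} \<in> edges (G i)"
      then have o: "owned u i" "owned v i" using edge[OF i] i by (auto simp: owned_def)
      have "fst (\<phi> i u) = fst (\<phi> i v)" "u \<noteq> v" using uv edge[OF i] by auto
      then have blk: "blk u = blk v" using own[OF o(1)] own[OF o(2)] by simp
      have c: "col (blk u) = i" "col (blk v) = i" using own_div o by blast+
      have "f u \<noteq> f v" using f_inj \<open>u \<noteq> v\<close> by blast
      then have "snd (\<phi> i (f u)) \<noteq> snd (\<phi> i (f v))"
        using \<phi>_inj[OF i, of "f u" "f v"] f_pos[of u] f_pos[of v] c blk by (auto simp: prod_eq_iff)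
      then show "{f u, f v} \<in> edges (G i)"
        unfolding edge[OF i]
        using f_pos[of u] f_pos[of v] c blk uv[unfolded edge[OF i]] own[OF o(1)] own[OF o(2)] by auto
    next
      assume uv: "{f u, f v} \<in> edges (G i)"
      then have V: "f u \<in> verts (G i)" "f v \<in> verts (G i)" using edge[OF i] by auto
      have c: "col (blk u) = i" "col (blk v) = i" using disj[OF col i] V f_pos by blast+
      have "J (blk u) = J (blk v)" using uv edge[OF i] f_pos[of u] f_pos[of v] c by simp
      then have "blk u = blk v" using J_inj c by simp
      moreover have "u \<noteq> v" using uv edge[OF i] by auto
      ultimately obtain i' where i': "owned u i'" "owned v i'" "fst (\<phi> i' u) = fst (\<phi> i' v)"
        using owned_eq by blast
      have "i' = i" using own_div[OF i'(1)] c by simp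
      note o = i'[unfolded this]
      have "snd (\<phi> i u) \<noteq> snd (\<phi> i v)"
        using \<phi>_inj[OF i, of u v] o \<open>u \<noteq> v\<close> by (auto simp: owned_def prod_eq_iff)
      then show "{u, v} \<in> edges (G i)"
        unfolding edge[OF i]
        using f_pos[of u] f_pos[of v] c uv[unfolded edge[OF i]] o[unfolded owned_def] own[OF o(1)] own[OF o(2)] by auto
    qed
    define K where "K = \<lparr>verts = range f, edges = {{a, b} |a b. a \<in> range f \<and> b \<in> range f \<and> a \<noteq> b}\<rparr>"
    have K_edge: "{a, b} \<in> edges K \<longleftrightarrow> a \<in> range f \<and> b \<in> range f \<and> a \<noteq> b" for a b
      by (auto simp: K_def doubleton_eq_iff)
    have injf: "inj f" using f_inj by (rule injI)
    have simple: "simple_graph K" by (auto simp: simple_graph_def K_def)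
    have "subgraph K K_aleph0"
      using simple by (auto simp: subgraph_def) (auto simp: K_def K_aleph0_def)
    moreover have "copy_of K K_aleph0"
      unfolding copy_of_def
    proof (intro conjI exI ballI)
      show "simple_graph K_aleph0" by (auto simp: simple_graph_def K_aleph0_def)
      show "bij_betw (inv f) (verts K) (verts K_aleph0)"
        using bij_betw_inv_into[OF inj_on_imp_bij_betw[OF injf]] by (simp add: K_def K_aleph0_def)
      fix a b assume "a \<in> verts K" "b \<in> verts K"
      then show "{a, b} \<in> edges K \<longleftrightarrow> {inv f a, inv f b} \<in> edges K_aleph0"
        using inv_into_injective[of UNIV f a b] unfolding edge_iff K_edge by (auto simp: K_def)
    qed (rule simple)
    moreover have "edges K \<subseteq> maker_edges p"
    proof
      fix e assume "e \<in> edges K"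
      then obtain u v where uv: "e = {f u, f v}" "f u \<noteq> f v" by (auto simp: K_def)
      then have "start (blk u) + idx u \<noteq> start (blk v) + idx v" by (metis f_def)
      then show "e \<in> maker_edges p" unfolding uv(1) f_def by (rule x(2))
    qed
    moreover have "bij_betw f (verts K_aleph0) (verts K)"
      using inj_on_imp_bij_betw[OF injf] by (simp add: K_def K_aleph0_def)
    ultimately show ?thesis using pattern unfolding MB_pat_def by blast
  qed
  then show ?thesis
    using branch_strategy unfolding maker_has_winning_strategy_def by meson
qed

end
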